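(* Let $\alpha\in(0,2)$ and let $A$ be a sectorial operator in a Banach space $X$ with spectral parameters $\rho_s>0$ and $\varphi_s<\pi\min\{\frac12,1-\frac\alpha2\}$. Let $a_0>0$ and set $$\phi_s=\min\left\{\pi,\frac{\pi-\varphi_s}{\alpha}\right\},\quad a_I=\frac{a_0}{\cos\phi_s}\cos\left(\frac{\phi_s}{2}+\frac\pi4\right),\quad b_I=-\frac{a_0}{\cos\phi_s}\sin\left(\frac{\phi_s}{2}+\frac\pi4\right),$$ $z(\xi)=a_0-a_I\cosh(\xi)+ib_I\sinh(\xi)$, $\xi\in(-\infty,\infty)$. Then for any $u_0\in D(A^\gamma)$, $\gamma>0$, and $u_1\in X$, the operator functions $S_\alpha(t)u_0$ and $S_{\alpha,2}(t)u_1$ admit the representations $$S_\alpha(t)u_0=\frac1{2\pi i}\int_{-\infty}^{\infty}e^{z(\xi)t}F_{\alpha,1}(\xi)u_0\,d\xi+u_0,\qquad F_{\alpha,1}(\xi)=z'(\xi)\left(z^{\alpha-1}(\xi)\left(z^\alpha(\xi)I+A\right)^{-1}-\frac1{z(\xi)}I\right),$$ $$S_{\alpha,2}(t)u_1=\frac1{2\pi i}\int_{-\infty}^{\infty}e^{z(\xi)t}F_{\alpha,2}(\xi)u_1\,d\xi,\qquad F_{\alpha,2}(\xi)=z'(\xi)z^{\alpha-2}(\xi)\left(z^\alpha(\xi)I+A\right)^{-1}.$$ Moreover, for arbitrary finite $t\ge0$ (i.e. for $t\in[0,T]$ with any finite $T$) both integrals are uniformly convergent.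
   Context: $X$ is a (complex) Banach space. For $\rho_s>0$, $\varphi_s<\pi/2$ let $\Sigma(\rho_s,\varphi_s)=\{z=\rho_s+\rho e^{i\theta}:\rho\in[0,\infty),\ |\theta|<\varphi_s\}$. A sectorial (strongly positive) operator $A$ with spectral parameters $\rho_s,\varphi_s$ is a closed linear operator with domain $D(A)$ dense in $X$, spectrum $\mathrm{Sp}(A)\subset\Sigma(\rho_s,\varphi_s)$, and resolvent bound $\|(zI-A)^{-1}\|\le \frac{M}{1+|z|}$ (for some constant $M$) for all $z$ outside $\Sigma(\rho_s,\varphi_s)$ and on its boundary. $A^\gamma$ denotes the fractional power; powers $z^\alpha$ of complex numbers are principal branches. For $\beta\ge1$, $$S_{\alpha,\beta}(t)x=\frac1{2\pi i}\int_\Gamma e^{zt}z^{\alpha-\beta}(z^\alpha I+A)^{-1}x\,dz,\qquad S_\alpha(t)\equiv S_{\alpha,1}(t),$$ where the contour $\Gamma$ is such that the integral converges and the curve $z^\alpha$, $z\in\Gamma$, is positively oriented with respect to $-\Sigma(\rho_s,\varphi_s)\cup\{0\}$ (for instance, $\Gamma$ consists of the rays $\rho e^{\pm i\theta}$, $\rho\ge r>0$, and the arc $re^{i\psi}$, $|\psi|\le\theta$, with $\frac{\pi}{2}<\theta<\phi_s$, traversed from $\infty e^{-i\theta}$ to $\infty e^{i\theta}$). At $t=0$, $S_\alpha(0)x=x$. Here $z'(\xi)=-a_I\sinh\xi+ib_I\cosh\xi$. *)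

theory Defs
  imports "HOL-Analysis.Analysis"
begin

class scaleC =
  fixes scaleC :: "complex \<Rightarrow> 'a \<Rightarrow> 'a"  (infixr "*\<^sub>C" 75)

class cbanach = banach + scaleC +
  assumes scaleR_scaleC: "r *\<^sub>R x = complex_of_real r *\<^sub>C x"
    and scaleC_add_right: "c *\<^sub>C (x + y) = c *\<^sub>C x + c *\<^sub>C y"
    and scaleC_add_left: "(c + d) *\<^sub>C x = c *\<^sub>C x + d *\<^sub>C x"
    and scaleC_scaleC: "c *\<^sub>C (d *\<^sub>C x) = (c * d) *\<^sub>C x"
    and norm_scaleC: "norm (c *\<^sub>C x) = cmod c * norm x"

instantiation complex :: cbanach
begin

definition scaleC_complex :: "complex \<Rightarrow> complex \<Rightarrow> complex"
  where "scaleC_complex c x = c * x"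

instance
  by standard (auto simp: scaleC_complex_def scaleR_conv_of_real norm_mult algebra_simps)

end

text \<open>An operator with domain \<open>D\<close> is a set \<open>D\<close> together with a total function \<open>A\<close>,
  of which only the values on \<open>D\<close> matter.\<close>

definition closed_operator :: "'a::cbanach set \<Rightarrow> ('a \<Rightarrow> 'a) \<Rightarrow> bool" where
  "closed_operator D A \<longleftrightarrow>
     0 \<in> D \<and> (\<forall>x\<in>D. \<forall>y\<in>D. x + y \<in> D \<and> A (x + y) = A x + A y) \<and>
     (\<forall>c. \<forall>x\<in>D. c *\<^sub>C x \<in> D \<and> A (c *\<^sub>C x) = c *\<^sub>C A x) \<and>
     closed {(x, A x) |x. x \<in> D}"

text \<open>\<open>resolvent D A z\<close> is $(zI-A)^{-1}$ and \<open>shift_inv D A w\<close> is $(wI+A)^{-1}$; they are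
  meaningful for \<open>z\<close>, respectively \<open>- w\<close>, in the resolvent set.\<close>

definition resolvent :: "'a::cbanach set \<Rightarrow> ('a \<Rightarrow> 'a) \<Rightarrow> complex \<Rightarrow> 'a \<Rightarrow> 'a" where
  "resolvent D A z = inv_into D (\<lambda>x. z *\<^sub>C x - A x)"

definition shift_inv :: "'a::cbanach set \<Rightarrow> ('a \<Rightarrow> 'a) \<Rightarrow> complex \<Rightarrow> 'a \<Rightarrow> 'a" where
  "shift_inv D A w = inv_into D (\<lambda>x. w *\<^sub>C x + A x)"

definition resolvent_set :: "'a::cbanach set \<Rightarrow> ('a \<Rightarrow> 'a) \<Rightarrow> complex set" where
  "resolvent_set D A =
     {z. bij_betw (\<lambda>x. z *\<^sub>C x - A x) D UNIV \<and> bounded_linear (resolvent D A z)}"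

definition spectrum :: "'a::cbanach set \<Rightarrow> ('a \<Rightarrow> 'a) \<Rightarrow> complex set" where
  "spectrum D A = - resolvent_set D A"

definition Sigma_sector :: "real \<Rightarrow> real \<Rightarrow> complex set" where
  "Sigma_sector \<rho>\<^sub>s \<phi> =
     {complex_of_real \<rho>\<^sub>s + complex_of_real \<rho> * cis \<theta> |\<rho> \<theta>. 0 \<le> \<rho> \<and> \<bar>\<theta>\<bar> < \<phi>}"

definition sectorial :: "'a::cbanach set \<Rightarrow> ('a \<Rightarrow> 'a) \<Rightarrow> real \<Rightarrow> real \<Rightarrow> bool" where
  "sectorial D A \<rho>\<^sub>s \<phi> \<longleftrightarrow>
     0 < \<rho>\<^sub>s \<and> \<phi> < pi / 2 \<and> closed_operator D A \<and> closure D = UNIV \<and>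
     spectrum D A \<subseteq> Sigma_sector \<rho>\<^sub>s \<phi> \<and>
     (\<exists>M. \<forall>z \<in> - Sigma_sector \<rho>\<^sub>s \<phi> \<union> frontier (Sigma_sector \<rho>\<^sub>s \<phi>).
        z \<in> resolvent_set D A \<and> onorm (resolvent D A z) \<le> M / (1 + cmod z))"

text \<open>For \<open>\<gamma> > 0\<close>, the bounded operator $A^{-\gamma}$ is the Dunford integral
  $\frac{1}{2\pi i}\int_C z^{-\gamma}(A-zI)^{-1}\,dz$ over a path \<open>C\<close> in the resolvent set that
  avoids $(-\infty,0]$ and has the spectrum on its right; $A^\gamma$ is the inverse of
  $A^{-\gamma}$, so that $D(A^\gamma)$ is the range of $A^{-\gamma}$.  We take for \<open>C\<close> the upward
  line $\mathrm{Re}\,z = \rho_s/2$, which separates the spectrum from $(-\infty,0]$; by Cauchy's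
  theorem any other admissible path gives the same operator.\<close>

definition neg_frac_power ::
    "'a::cbanach set \<Rightarrow> ('a \<Rightarrow> 'a) \<Rightarrow> real \<Rightarrow> real \<Rightarrow> 'a \<Rightarrow> 'a" where
  "neg_frac_power D A \<rho>\<^sub>s \<gamma> x =
     - ((1 / (2 * of_real pi * \<i>)) *\<^sub>C
        integral UNIV (\<lambda>\<eta>. let z = Complex (\<rho>\<^sub>s / 2) \<eta> in
          (z powr (- complex_of_real \<gamma>) * \<i>) *\<^sub>C resolvent D A z x))"

definition frac_power_domain ::
    "'a::cbanach set \<Rightarrow> ('a \<Rightarrow> 'a) \<Rightarrow> real \<Rightarrow> real \<Rightarrow> 'a set" where
  "frac_power_domain D A \<rho>\<^sub>s \<gamma> = range (neg_frac_power D A \<rho>\<^sub>s \<gamma>)"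

text \<open>Integral of a vector-valued function over the rays $\rho e^{\pm i\theta}$, \<open>\<rho> \<ge> r\<close>, and the
  arc $re^{i\psi}$, \<open>\<bar>\<psi>\<bar> \<le> \<theta>\<close>, traversed from $\infty e^{-i\theta}$ to $\infty e^{i\theta}$
  (on the lower ray \<open>\<rho>\<close> decreases, hence the minus sign).\<close>

definition ray_arc_integral ::
    "real \<Rightarrow> real \<Rightarrow> (complex \<Rightarrow> 'a::cbanach) \<Rightarrow> 'a" where
  "ray_arc_integral r \<theta> f =
     - integral {r..} (\<lambda>\<rho>. cis (- \<theta>) *\<^sub>C f (of_real \<rho> * cis (- \<theta>)))
     + integral {- \<theta>..\<theta>} (\<lambda>\<psi>. (\<i> * of_real r * cis \<psi>) *\<^sub>C f (of_real r * cis \<psi>))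
     + integral {r..} (\<lambda>\<rho>. cis \<theta> *\<^sub>C f (of_real \<rho> * cis \<theta>))"

definition S_ab ::
    "'a::cbanach set \<Rightarrow> ('a \<Rightarrow> 'a) \<Rightarrow> real \<Rightarrow> real \<Rightarrow> real \<Rightarrow> real \<Rightarrow> real \<Rightarrow> 'a \<Rightarrow> 'a" where
  "S_ab D A r \<theta> \<alpha> \<beta> t x =
     (1 / (2 * of_real pi * \<i>)) *\<^sub>C ray_arc_integral r \<theta>
       (\<lambda>z. (exp (z * of_real t) * z powr complex_of_real (\<alpha> - \<beta>)) *\<^sub>C
             shift_inv D A (z powr complex_of_real \<alpha>) x)"

text \<open>At \<open>t = 0\<close> the integral for \<open>\<beta> = 1\<close> need not converge absolutely; the value there is the
  identity by convention.\<close>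

definition S_a ::
    "'a::cbanach set \<Rightarrow> ('a \<Rightarrow> 'a) \<Rightarrow> real \<Rightarrow> real \<Rightarrow> real \<Rightarrow> real \<Rightarrow> 'a \<Rightarrow> 'a" where
  "S_a D A r \<theta> \<alpha> t x = (if t = 0 then x else S_ab D A r \<theta> \<alpha> 1 t x)"

definition hyperbola :: "real \<Rightarrow> real \<Rightarrow> real \<Rightarrow> real \<Rightarrow> complex" where
  "hyperbola a\<^sub>0 a b \<xi> = of_real a\<^sub>0 - of_real (a * cosh \<xi>) + \<i> * of_real (b * sinh \<xi>)"

definition hyperbola' :: "real \<Rightarrow> real \<Rightarrow> real \<Rightarrow> complex" where
  "hyperbola' a b \<xi> = - of_real (a * sinh \<xi>) + \<i> * of_real (b * cosh \<xi>)"

definition F1 ::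
    "'a::cbanach set \<Rightarrow> ('a \<Rightarrow> 'a) \<Rightarrow> real \<Rightarrow> real \<Rightarrow> real \<Rightarrow> real \<Rightarrow> real \<Rightarrow> 'a \<Rightarrow> 'a" where
  "F1 D A \<alpha> a\<^sub>0 a b \<xi> x = (let z = hyperbola a\<^sub>0 a b \<xi> in
     hyperbola' a b \<xi> *\<^sub>C
       (z powr complex_of_real (\<alpha> - 1) *\<^sub>C shift_inv D A (z powr complex_of_real \<alpha>) x
        - (1 / z) *\<^sub>C x))"

definition F2 ::
    "'a::cbanach set \<Rightarrow> ('a \<Rightarrow> 'a) \<Rightarrow> real \<Rightarrow> real \<Rightarrow> real \<Rightarrow> real \<Rightarrow> real \<Rightarrow> 'a \<Rightarrow> 'a" where
  "F2 D A \<alpha> a\<^sub>0 a b \<xi> x = (let z = hyperbola a\<^sub>0 a b \<xi> in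
     (hyperbola' a b \<xi> * z powr complex_of_real (\<alpha> - 2)) *\<^sub>C
       shift_inv D A (z powr complex_of_real \<alpha>) x)"

text \<open>Uniform convergence, for parameters in \<open>S\<close>, of an improper integral over the real line: the
  truncations to \<open>{a..b}\<close> tend to the full integral as \<open>a\<close> and \<open>b\<close> tend independently to
  $-\infty$ and $+\infty$.\<close>

definition uniformly_convergent_integral ::
    "'t set \<Rightarrow> ('t \<Rightarrow> real \<Rightarrow> 'a::banach) \<Rightarrow> bool" where
  "uniformly_convergent_integral S f \<longleftrightarrow>
     (\<forall>t\<in>S. f t integrable_on UNIV) \<and>
     uniform_limit S (\<lambda>(a, b) t. integral {a..b} (f t)) (\<lambda>t. integral UNIV (f t))
       (at_bot \<times>\<^sub>F at_top)"

end

theory Submission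
  imports Defs
begin

text \<open>With \<open>z = exp \<zeta>\<close> the sector \<open>\<bar>arg z\<bar> < \<phi>\<^sub>s\<close>, on which \<open>- z\<^sup>\<alpha>\<close> avoids \<open>\<Sigma>(\<rho>\<^sub>s, \<phi>)\<close>, becomes the
  convex strip \<open>\<bar>Im \<zeta>\<bar> < \<phi>\<^sub>s\<close>, where each integrand has a primitive.  The integrands are
  \<open>O(exp (- \<delta> Re \<zeta>))\<close>, uniformly in \<open>t \<ge> 0\<close>, on the two half-strips
  \<open>\<pi>/2 < \<theta>\<^sub>1 \<le> \<bar>Im \<zeta>\<bar> \<le> \<theta>\<^sub>2 < \<phi>\<^sub>s\<close>, so the primitive has one limit at the end of each of them, approached at
  a uniform rate.  Both the rays and the branches of the hyperbola run into these ends: the two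
  integrals are the same difference of limits, and that of the hyperbola converges uniformly.  For
  \<open>S\<^sub>\<alpha>\<close> the decay holds after subtracting \<open>u\<^sub>0 / z\<close>, because \<open>u\<^sub>0 \<in> D(A\<^sup>\<gamma>)\<close>; the subtracted
  term contributes \<open>2\<pi>\<i> u\<^sub>0\<close> when \<open>t > 0\<close>.  When \<open>t = 0\<close> the decay holds in the whole half-strip
  \<open>\<bar>Im \<zeta>\<bar> \<le> \<theta>\<^sub>2\<close>, so the two limits coincide and the integral vanishes.\<close>

section \<open>Continuously differentiable functions of a complex variable\<close>

text \<open>The integrands take values in a Banach space, so contour deformation is replaced by
  comparing end values of one primitive; this asks only for continuous complex differentiability on
  a convex set, which the resolvent identity provides. The bound on \<phi> says that (\<pi> -
  \<phi>) / \<alpha> exceeds \<pi>/2 and so leaves room for directions in the left half-plane. The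
  estimates must cover t = 0, where exp (z t) gives no decay: it enters only through |exp (z t)|
  \<le> 1 for Re z \<le> 0, and this makes the convergence uniform in t. Decay has to come from the
  resolvent. With dz = z d\<zeta>, the case \<beta> = 2 leaves |z|^(\<alpha> - 1) M / (1 +
  |z|^\<alpha>), which is at most M / |z|. The case \<beta> = 1 leaves z^\<alpha> (z^\<alpha> I +
  A)^(-1), for which the resolvent bound yields boundedness only. Hence the subtraction of the
  identity and the condition on \<open>u\<^sub>0\<close>, which supplies a rate |z|^(- \<alpha>
  \<delta>).\<close>

lemma bounded_bilinear_scaleC:
  "bounded_bilinear (scaleC :: complex \<Rightarrow> 'a::cbanach \<Rightarrow> 'a)"
proof
  fix a a' :: complex and b b' :: 'a and r :: real
  show "(a + a') *\<^sub>C b = a *\<^sub>C b + a' *\<^sub>C b" by (rule scaleC_add_left)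
  show "a *\<^sub>C (b + b') = a *\<^sub>C b + a *\<^sub>C b'" by (rule scaleC_add_right)
  show "(r *\<^sub>R a) *\<^sub>C b = r *\<^sub>R (a *\<^sub>C b)"
    by (simp add: scaleR_conv_of_real[of r a] scaleR_scaleC[of r "a *\<^sub>C b"] scaleC_scaleC)
  show "a *\<^sub>C (r *\<^sub>R b) = r *\<^sub>R (a *\<^sub>C b)"
    by (simp add: scaleR_scaleC scaleC_scaleC mult.commute)
  show "\<exists>K. \<forall>a b. norm ((a::complex) *\<^sub>C (b::'a)) \<le> norm a * norm b * K"
    by (rule exI[of _ 1]) (simp add: norm_scaleC)
qed

interpretation scaleC: bounded_bilinear "scaleC :: complex \<Rightarrow> 'a::cbanach \<Rightarrow> 'a"
  by (rule bounded_bilinear_scaleC)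

lemmas [continuous_intros] = scaleC.continuous_on scaleC.continuous
lemmas [tendsto_intros] = scaleC.tendsto
lemmas [derivative_intros] = scaleC.FDERIV

lemma scaleC_one [simp]: "1 *\<^sub>C x = (x::'a::cbanach)"
  using scaleR_scaleC[of 1 x] by simp

lemma scaleC_zero [simp]: "0 *\<^sub>C x = (0::'a::cbanach)" "c *\<^sub>C (0::'a) = 0"
  by (rule scaleC.zero_left scaleC.zero_right)+

lemma scaleC_minus_one: "(-1) *\<^sub>C x = - (x::'a::cbanach)"
  using scaleC.minus_left[of 1 x] by simp

text \<open>The Leibniz rule takes derivatives as elements of the space of bounded linear maps; this
  embeds a complex derivative x there as h \<mapsto> h x.\<close>

lift_definition blinfun_scaleC_left :: "'a::cbanach \<Rightarrow> complex \<Rightarrow>\<^sub>L 'a" is "\<lambda>x c. c *\<^sub>C x"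
  by (rule scaleC.bounded_linear_left)

lemma bounded_linear_blinfun_scaleC_left: "bounded_linear blinfun_scaleC_left"
  by transfer (rule bounded_bilinear.flip[OF bounded_bilinear_scaleC])

lemmas continuous_on_blinfun_scaleC_left [continuous_intros] =
  bounded_linear.continuous_on[OF bounded_linear_blinfun_scaleC_left]

text \<open>\<open>has_derivative\<close> is only real-linear; prescribing the form h \<mapsto> h f'
  builds in the Cauchy-Riemann equations for Banach space values.\<close>

definition has_cderiv :: "(complex \<Rightarrow> 'a::cbanach) \<Rightarrow> 'a \<Rightarrow> complex \<Rightarrow> bool"
  where "has_cderiv f f' z \<longleftrightarrow> (f has_derivative (\<lambda>h. h *\<^sub>C f')) (at z)"

definition c1_on :: "complex set \<Rightarrow> (complex \<Rightarrow> 'a::cbanach) \<Rightarrow> bool"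
  where "c1_on V f \<longleftrightarrow> (\<exists>f'. (\<forall>z\<in>V. has_cderiv f (f' z) z) \<and> continuous_on V f')"

lemma has_cderiv_complex: "has_cderiv f f' z \<longleftrightarrow> (f has_field_derivative f') (at z)"
  by (simp add: has_cderiv_def scaleC_complex_def has_field_derivative_def mult.commute[of _ f'])

lemma has_cderiv_add:
  "has_cderiv f f' z \<Longrightarrow> has_cderiv g g' z \<Longrightarrow> has_cderiv (\<lambda>z. f z + g z) (f' + g') z"
  unfolding has_cderiv_def
  by (auto intro!: derivative_eq_intros simp: scaleC_add_right)

lemma has_cderiv_const: "has_cderiv (\<lambda>_. c) 0 z"
  unfolding has_cderiv_def by simp

lemma has_cderiv_scaleC:
  "has_cderiv c c' z \<Longrightarrow> has_cderiv f f' z \<Longrightarrow>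
    has_cderiv (\<lambda>z. c z *\<^sub>C f z) (c z *\<^sub>C f' + c' *\<^sub>C f z) z"
  unfolding has_cderiv_def
  by (auto intro!: derivative_eq_intros ext
      simp: scaleC_add_right scaleC_scaleC scaleC_complex_def mult.commute)

lemma has_cderiv_continuous: "has_cderiv f f' z \<Longrightarrow> isCont f z"
  unfolding has_cderiv_def by (rule has_derivative_continuous)

lemma c1_on_continuous: "c1_on V f \<Longrightarrow> continuous_on V f"
  unfolding c1_on_def by (meson continuous_at_imp_continuous_on has_cderiv_continuous)

lemma c1_on_add: "c1_on V f \<Longrightarrow> c1_on V g \<Longrightarrow> c1_on V (\<lambda>z. f z + g z)"
  unfolding c1_on_def
  by (metis (mono_tags, lifting) has_cderiv_add continuous_on_add)

lemma c1_on_const: "c1_on V (\<lambda>_. c)"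
  unfolding c1_on_def by (intro exI[of _ "\<lambda>_. 0"]) (auto simp: has_cderiv_const)

lemma c1_on_scaleC:
  assumes "c1_on V c" "c1_on V f" shows "c1_on V (\<lambda>z. c z *\<^sub>C f z)"
proof -
  obtain c' f' where "\<forall>z\<in>V. has_cderiv c (c' z) z" "continuous_on V c'"
     "\<forall>z\<in>V. has_cderiv f (f' z) z" "continuous_on V f'"
    using assms unfolding c1_on_def by blast
  then show ?thesis
    unfolding c1_on_def
    using c1_on_continuous[OF assms(1)] c1_on_continuous[OF assms(2)]
    by (intro exI[of _ "\<lambda>z. c z *\<^sub>C f' z + c' z *\<^sub>C f z"] conjI continuous_intros ballI
        has_cderiv_scaleC) auto
qed

lemma c1_on_mult:
  fixes f g :: "complex \<Rightarrow> complex"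
  shows "c1_on V f \<Longrightarrow> c1_on V g \<Longrightarrow> c1_on V (\<lambda>z. f z * g z)"
  using c1_on_scaleC[of V f g] by (simp add: scaleC_complex_def)

lemma c1_on_cmult: "c1_on V (f :: complex \<Rightarrow> complex) \<Longrightarrow> c1_on V (\<lambda>z. c * f z)"
  by (rule c1_on_mult[OF c1_on_const])

lemma c1_on_ident: "c1_on V (\<lambda>z. z)"
  unfolding c1_on_def has_cderiv_complex by (intro exI[of _ "\<lambda>_. 1"]) auto

lemma c1_on_exp:
  fixes f :: "complex \<Rightarrow> complex"
  assumes "c1_on V f" shows "c1_on V (\<lambda>z. exp (f z))"
proof -
  obtain f' where "\<forall>z\<in>V. has_cderiv f (f' z) z" "continuous_on V f'"
    using assms unfolding c1_on_def by blast
  then show ?thesis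
    using c1_on_continuous[OF assms] unfolding c1_on_def has_cderiv_complex
    by (intro exI[of _ "\<lambda>z. exp (f z) * f' z"])
       (auto intro!: derivative_eq_intros continuous_on_mult continuous_on_exp)
qed

text \<open>The primitive is the integral of f along the segment from a base point p, as in the
  Poincare lemma. Continuity of f' allows differentiation under the integral sign.\<close>

theorem c1_on_primitive:
  fixes f :: "complex \<Rightarrow> 'a::cbanach"
  assumes "convex V" "open V" "c1_on V f"
  obtains G where "\<And>z. z \<in> V \<Longrightarrow> has_cderiv G (f z) z"
proof (cases "V = {}")
  case False
  then obtain p where p: "p \<in> V" by blast
  obtain f' where f': "\<And>z. z \<in> V \<Longrightarrow> has_cderiv f (f' z) z" and contf': "continuous_on V f'"
    using assms unfolding c1_on_def by blast
  have contf: "continuous_on V f" by (rule c1_on_continuous[OF assms(3)])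
  let ?q = "\<lambda>z t. p + of_real t * (z - p)"
  have q: "?q z t \<in> V" if "z \<in> V" "t \<in> {0..1}" for z t
  proof -
    have "(1 - t) *\<^sub>R p + t *\<^sub>R z \<in> V"
      using that p \<open>convex V\<close> by (intro convexD_alt) auto
    then show ?thesis by (simp add: scaleR_conv_of_real algebra_simps)
  qed
  define g where "g = (\<lambda>z t. (z - p) *\<^sub>C f (?q z t))"
  define g' where "g' = (\<lambda>z t. f (?q z t) + (of_real t * (z - p)) *\<^sub>C f' (?q z t))"
  define G where "G = (\<lambda>z. integral (cbox 0 1) (g z))"
  have contq: "continuous_on (V \<times> cbox 0 1) (\<lambda>(z, t). ?q z t)"
    by (auto simp: split_beta intro!: continuous_intros)
  have cont2: "continuous_on (V \<times> cbox 0 1) (\<lambda>(z, t). h (?q z t))"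
    if "continuous_on V h" for h :: "complex \<Rightarrow> 'a"
    using continuous_on_compose2[OF that contq] q by (force simp: split_beta)
  have cont1: "continuous_on {0..1} (\<lambda>t. h (?q z t))"
    if "continuous_on V h" "z \<in> V" for h :: "complex \<Rightarrow> 'a" and z
    using q[OF that(2)]
    by (intro continuous_on_compose2[OF that(1)] continuous_intros) auto
  have "has_cderiv G (f z) z" if z: "z \<in> V" for z
  proof -
    have "(G has_derivative integral (cbox 0 1) (\<lambda>t. blinfun_scaleC_left (g' z t))) (at z within V)"
      unfolding G_def
    proof (rule leibniz_rule[where U = V])
      fix x t assume x: "x \<in> V" "t \<in> cbox (0::real) 1"
      have "((\<lambda>z. f (?q z t)) has_derivative (\<lambda>h. (of_real t * h) *\<^sub>C f' (?q x t))) (at x)"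
        using f'[OF q[OF x(1)], of t] x
        unfolding has_cderiv_def
        by (intro has_derivative_compose[of "\<lambda>z. ?q z t" _ x UNIV f]) (auto intro!: derivative_eq_intros)
      then have "((\<lambda>z. g z t) has_derivative (\<lambda>h. h *\<^sub>C g' x t)) (at x)"
        unfolding g_def g'_def
        by (auto intro!: derivative_eq_intros ext simp: scaleC_add_right scaleC_scaleC algebra_simps)
      then show "((\<lambda>x. g x t) has_derivative blinfun_apply (blinfun_scaleC_left (g' x t))) (at x within V)"
        by (simp add: blinfun_scaleC_left.rep_eq has_derivative_at_withinI)
    next
      fix x assume "x \<in> V"
      then show "g x integrable_on cbox 0 1"
        unfolding g_def using cont1[OF contf]
        by (intro integrable_continuous continuous_intros) auto
    next
      show "continuous_on (V \<times> cbox 0 1) (\<lambda>(x, t). blinfun_scaleC_left (g' x t))"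
        unfolding g'_def split_beta
        using cont2[OF contf] cont2[OF contf'] 
        by (intro continuous_intros) (auto simp: split_beta)
    qed (use z assms in auto)
    then have 1: "(G has_derivative integral (cbox 0 1) (\<lambda>t. blinfun_scaleC_left (g' z t))) (at z)"
      by (simp only: at_within_open[OF z \<open>open V\<close>])
    have contg': "continuous_on {0..1} (g' z)"
      unfolding g'_def
      by (intro continuous_on_add scaleC.continuous_on cont1[OF contf z] cont1[OF contf' z])
         (intro continuous_intros)
    \<comment> \<open>The z-derivative \<open>g'\<close> of the integrand is also the t-derivative
      of t f (p + t (z - p)), so it integrates to f z.\<close>
    have "(g' z has_integral (1 *\<^sub>R f (?q z 1) - 0 *\<^sub>R f (?q z 0))) {0..1}"
    proof (rule fundamental_theorem_of_calculus)
      fix t :: real assume t: "t \<in> {0..1}"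
      have "((\<lambda>t. f (?q z t)) has_derivative (\<lambda>h. (of_real h * (z - p)) *\<^sub>C f' (?q z t))) (at t)"
        using f'[OF q[OF z t]]
        unfolding has_cderiv_def
        by (intro has_derivative_compose[of "\<lambda>t. ?q z t" _ t UNIV f]) (auto intro!: derivative_eq_intros)
      then have "((\<lambda>t. t *\<^sub>R f (?q z t)) has_derivative (\<lambda>h. h *\<^sub>R g' z t)) (at t)"
        unfolding g'_def
        by (auto intro!: derivative_eq_intros ext simp: scaleR_scaleC scaleC_add_right scaleC_scaleC algebra_simps)
      then show "((\<lambda>t. t *\<^sub>R f (?q z t)) has_vector_derivative g' z t) (at t within {0..1})"
        by (simp add: has_vector_derivative_def has_derivative_at_withinI)
    qed simp
    then have 2: "integral (cbox 0 1) (g' z) = f z"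
      by (simp add: integral_unique)
    have "blinfun_apply (integral (cbox 0 1) (\<lambda>t. blinfun_scaleC_left (g' z t))) h = h *\<^sub>C f z" for h
    proof -
      have "blinfun_apply (integral (cbox 0 1) (\<lambda>t. blinfun_scaleC_left (g' z t))) h
         = integral (cbox 0 1) (\<lambda>t. h *\<^sub>C g' z t)"
        using contg'
        by (subst blinfun_apply_integral)
           (auto intro!: integrable_continuous_real continuous_intros simp: blinfun_scaleC_left.rep_eq)
      also have "\<dots> = h *\<^sub>C integral (cbox 0 1) (g' z)"
        using integral_linear[OF _ scaleC.bounded_linear_right, of "g' z" "cbox 0 1" h] contg'
        by (auto simp: o_def intro!: integrable_continuous_real)
      finally show ?thesis using 2 by simp
    qed
    then show ?thesis using 1 unfolding has_cderiv_def by presburger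
  qed
  then show thesis using that by blast
qed (use that in auto)

section \<open>Contour integrals as differences of limits\<close>

lemma has_vector_derivative_compose_cderiv:
  assumes "has_cderiv G g (\<zeta> s)" "(\<zeta> has_vector_derivative \<zeta>') (at s within T)"
  shows "((\<lambda>s. G (\<zeta> s)) has_vector_derivative \<zeta>' *\<^sub>C g) (at s within T)"
proof -
  have "((\<lambda>s. G (\<zeta> s)) has_derivative (\<lambda>h. (h *\<^sub>R \<zeta>') *\<^sub>C g)) (at s within T)"
    using assms unfolding has_cderiv_def has_vector_derivative_def
    by (rule has_derivative_compose[rotated])
  then show ?thesis
    unfolding has_vector_derivative_def by (simp add: scaleC.scaleR_left)
qed

text \<open>Two points of the half-strip are joined by a vertical segment, which costs at most C
  (\<open>\<theta>\<^sub>2 - \<theta>\<^sub>1\<close>) exp (- \<delta> Re z), and a horizontal one,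
  which costs at most the tail integral (C / \<delta>) exp (- \<delta> Re z). So G is Cauchy towards
  the end, with a limit independent of Im z.\<close>

lemma primitive_limit_at_end:
  fixes G :: "complex \<Rightarrow> 'a::cbanach"
  assumes "0 < \<delta>" "\<theta>\<^sub>1 \<le> \<theta>\<^sub>2"
    and prim: "\<And>z. 0 \<le> Re z \<Longrightarrow> Im z \<in> {\<theta>\<^sub>1..\<theta>\<^sub>2} \<Longrightarrow> has_cderiv G (g z) z"
    and bound: "\<And>z. 0 \<le> Re z \<Longrightarrow> Im z \<in> {\<theta>\<^sub>1..\<theta>\<^sub>2} \<Longrightarrow> norm (g z) \<le> C * exp (- \<delta> * Re z)"
  obtains L where "\<And>z. 0 \<le> Re z \<Longrightarrow> Im z \<in> {\<theta>\<^sub>1..\<theta>\<^sub>2} \<Longrightarrow>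
    norm (G z - L) \<le> C * (\<theta>\<^sub>2 - \<theta>\<^sub>1 + 1 / \<delta>) * exp (- \<delta> * Re z)"
proof -
  \<comment> \<open>The sign of \<open>C\<close> is not assumed; it follows from the norm bound at a
    point of the half-strip.\<close>
  have C: "0 \<le> C * exp (- \<delta> * x)" if "0 \<le> x" for x
    using bound[of "Complex x \<theta>\<^sub>1"] that \<open>\<theta>\<^sub>1 \<le> \<theta>\<^sub>2\<close> norm_ge_zero[of "g (Complex x \<theta>\<^sub>1)"]
    by (metis atLeastAtMost_iff complex.sel order.refl order.trans)
  have horiz: "norm (G (Complex b y) - G (Complex a y)) \<le> C / \<delta> * exp (- \<delta> * a)"
    if "0 \<le> a" "a \<le> b" "y \<in> {\<theta>\<^sub>1..\<theta>\<^sub>2}" for a b y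
  proof (cases "a = b")
    case True
    then show ?thesis using C[OF that(1)] \<open>0 < \<delta>\<close> by simp
  next
    case False
    \<comment> \<open>An antiderivative of the bound C exp (- \<delta> x), as comparison function in
      the mean value inequality.\<close>
    let ?\<phi> = "\<lambda>x. - (C / \<delta> * exp (- \<delta> * x))"
    have der: "((\<lambda>x. G (Complex x y)) has_vector_derivative g (Complex x y)) (at x)" if "a \<le> x" for x
    proof -
      have "((\<lambda>x. Complex x y) has_vector_derivative 1) (at x)"
        by (auto simp: Complex_eq has_vector_derivative_def scaleR_conv_of_real intro!: derivative_eq_intros)
      from has_vector_derivative_compose_cderiv[OF prim this] show ?thesis
        using that \<open>0 \<le> a\<close> \<open>y \<in> _\<close> by simp
    qed
    have "norm (G (Complex b y) - G (Complex a y)) \<le> ?\<phi> b - ?\<phi> a"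
    proof (rule differentiable_bound_general[where f' = "\<lambda>x. g (Complex x y)"])
      show "continuous_on {a..b} ?\<phi>"
        using \<open>0 < \<delta>\<close> by (intro continuous_intros) auto
      show "continuous_on {a..b} (\<lambda>x. G (Complex x y))"
        using der by (intro continuous_at_imp_continuous_on ballI)
          (auto intro: has_vector_derivative_continuous)
      show "(?\<phi> has_vector_derivative C * exp (- \<delta> * x)) (at x)" for x
        using \<open>0 < \<delta>\<close> unfolding has_real_derivative_iff_has_vector_derivative[symmetric]
        by (auto intro!: derivative_eq_intros)
    qed (use False that der bound[of "Complex _ y"] in auto)
    also have "\<dots> \<le> C / \<delta> * exp (- \<delta> * a)"
      using C[of b] that \<open>0 < \<delta>\<close> by simp
    finally show ?thesis .
  qed
  have vert: "norm (G (Complex x b) - G (Complex x a)) \<le> C * exp (- \<delta> * x) * \<bar>b - a\<bar>"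
    if "0 \<le> x" "a \<in> {\<theta>\<^sub>1..\<theta>\<^sub>2}" "b \<in> {\<theta>\<^sub>1..\<theta>\<^sub>2}" for a b x
  proof -
    have "norm ((\<lambda>y. G (Complex x y)) b - (\<lambda>y. G (Complex x y)) a) \<le> C * exp (- \<delta> * x) * norm (b - a)"
    proof (rule differentiable_bound[where f' = "\<lambda>y h. h *\<^sub>R \<i> *\<^sub>C g (Complex x y)"])
      show "onorm (\<lambda>h. h *\<^sub>R \<i> *\<^sub>C g (Complex x y)) \<le> C * exp (- \<delta> * x)" if "y \<in> {\<theta>\<^sub>1..\<theta>\<^sub>2}" for y
        using bound[of "Complex x y"] that \<open>0 \<le> x\<close>
        by (intro onorm_le) (simp add: norm_scaleC mult.commute mult_left_mono)
      show "((\<lambda>y. G (Complex x y)) has_derivative (\<lambda>h. h *\<^sub>R \<i> *\<^sub>C g (Complex x y))) (at y within {\<theta>\<^sub>1..\<theta>\<^sub>2})"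
        if "y \<in> {\<theta>\<^sub>1..\<theta>\<^sub>2}" for y
      proof -
        have "((\<lambda>y. Complex x y) has_vector_derivative \<i>) (at y within {\<theta>\<^sub>1..\<theta>\<^sub>2})"
          by (auto simp: Complex_eq has_vector_derivative_def scaleR_conv_of_real intro!: derivative_eq_intros)
        from has_vector_derivative_compose_cderiv[OF prim this] show ?thesis
          using that \<open>0 \<le> x\<close> by (simp add: has_vector_derivative_def)
      qed
    qed (use that in auto)
    then show ?thesis by simp
  qed
  define K where "K = C * (\<theta>\<^sub>2 - \<theta>\<^sub>1 + 1 / \<delta>)"
  have le: "norm (G w - G z) \<le> K * exp (- \<delta> * Re z)"
    if "0 \<le> Re z" "Re z \<le> Re w" "Im z \<in> {\<theta>\<^sub>1..\<theta>\<^sub>2}" "Im w \<in> {\<theta>\<^sub>1..\<theta>\<^sub>2}" for w z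
  proof -
    have "norm (G w - G z) \<le> norm (G (Complex (Re w) (Im w)) - G (Complex (Re z) (Im w)))
        + norm (G (Complex (Re z) (Im w)) - G (Complex (Re z) (Im z)))"
      using norm_triangle_ineq[of "G w - G (Complex (Re z) (Im w))" "G (Complex (Re z) (Im w)) - G z"] by simp
    also have "\<dots> \<le> C / \<delta> * exp (- \<delta> * Re z) + C * exp (- \<delta> * Re z) * \<bar>Im w - Im z\<bar>"
      using that by (intro add_mono horiz vert) auto
    also have "\<dots> \<le> C / \<delta> * exp (- \<delta> * Re z) + C * exp (- \<delta> * Re z) * (\<theta>\<^sub>2 - \<theta>\<^sub>1)"
      using that C[of "Re z"] by (intro add_left_mono mult_left_mono) auto
    also have "\<dots> = K * exp (- \<delta> * Re z)" by (simp add: K_def algebra_simps)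
    finally show ?thesis .
  qed
  \<comment> \<open>The lower edge is an arbitrary choice of path: \<open>le\<close> compares points
    with different imaginary parts.\<close>
  define a where "a = (\<lambda>n. G (Complex (real n) \<theta>\<^sub>1))"
  have lim0: "(\<lambda>n. K * exp (- \<delta> * real n)) \<longlonglongrightarrow> 0"
    using \<open>0 < \<delta>\<close> by real_asymp
  have "Cauchy a"
  proof (rule metric_CauchyI)
    fix e :: real assume "0 < e"
    then obtain N where N: "K * exp (- \<delta> * real N) < e / 2"
      using order_tendstoD(2)[OF lim0, of "e/2"] by (auto simp: eventually_sequentially)
    have *: "norm (a n - a N) < e / 2" if "N \<le> n" for n
      using le[of "Complex (real N) \<theta>\<^sub>1" "Complex (real n) \<theta>\<^sub>1"] that N \<open>\<theta>\<^sub>1 \<le> \<theta>\<^sub>2\<close>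
      unfolding a_def by simp
    show "\<exists>M. \<forall>m\<ge>M. \<forall>n\<ge>M. dist (a m) (a n) < e"
    proof (intro exI[of _ N] allI impI)
      fix m n assume "N \<le> m" "N \<le> n"
      from *[OF this(1)] *[OF this(2)] show "dist (a m) (a n) < e"
        by (metis dist_norm dist_commute dist_triangle_half_l)
    qed
  qed
  then obtain L where L: "a \<longlonglongrightarrow> L" by (auto simp: Cauchy_convergent_iff convergent_def)
  have "norm (G z - L) \<le> K * exp (- \<delta> * Re z)" if "0 \<le> Re z" "Im z \<in> {\<theta>\<^sub>1..\<theta>\<^sub>2}" for z
  proof (rule tendsto_upperbound)
    show "(\<lambda>n. norm (G z - a n)) \<longlonglongrightarrow> norm (G z - L)" by (intro tendsto_intros L)
    show "\<forall>\<^sub>F n in sequentially. norm (G z - a n) \<le> K * exp (- \<delta> * Re z)"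
      using eventually_ge_at_top[of "nat \<lceil>Re z\<rceil>"]
    proof eventually_elim
      case (elim n)
      then have "Re z \<le> real n" by linarith
      then show ?case
        using le[of z "Complex (real n) \<theta>\<^sub>1"] that \<open>\<theta>\<^sub>1 \<le> \<theta>\<^sub>2\<close> by (simp add: a_def norm_minus_commute)
    qed
  qed simp
  then show thesis using that K_def by blast
qed

lemma tendsto_by_exp_bound:
  fixes f :: "real \<Rightarrow> 'a::real_normed_vector"
  assumes "0 < \<delta>" and "\<And>x. 0 \<le> x \<Longrightarrow> norm (f x - L) \<le> K * exp (- \<delta> * x)"
  shows "(f \<longlongrightarrow> L) at_top"
proof (rule LIM_zero_cancel, rule Lim_null_comparison)
  show "\<forall>\<^sub>F x in at_top. norm (f x - L) \<le> K * exp (- \<delta> * x)"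
    using eventually_ge_at_top[of 0] by eventually_elim (rule assms(2))
  show "((\<lambda>x. K * exp (- \<delta> * x)) \<longlongrightarrow> 0) at_top"
    using \<open>0 < \<delta>\<close> by real_asymp
qed

text \<open>The gauge integral over the line is a limit over all large boxes, and the fundamental
  theorem evaluates it on each; limits of the antiderivative at both ends are enough.\<close>

lemma has_integral_UNIV_by_limits:
  fixes \<Phi> :: "real \<Rightarrow> 'a::banach"
  assumes der: "\<And>s. (\<Phi> has_vector_derivative f s) (at s)"
    and top: "(\<Phi> \<longlongrightarrow> P) at_top" and bot: "(\<Phi> \<longlongrightarrow> N) at_bot"
  shows "(f has_integral P - N) UNIV"
proof -
  have nb: "\<not> (\<exists>a b. UNIV = cbox a (b::real))"
    by (metis bounded_cbox not_bounded_UNIV)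
  have "\<exists>B>0. \<forall>a b. ball 0 B \<subseteq> cbox a b \<longrightarrow>
      (\<exists>z. (f has_integral z) (cbox a b) \<and> norm (z - (P - N)) < e)" if e: "0 < e" for e
  proof -
    obtain b0 where b0: "\<And>b. b0 \<le> b \<Longrightarrow> norm (\<Phi> b - P) < e / 2"
      using tendstoD[OF top, of "e/2"] e by (auto simp: eventually_at_top_linorder dist_norm)
    obtain a0 where a0: "\<And>a. a \<le> a0 \<Longrightarrow> norm (\<Phi> a - N) < e / 2"
      using tendstoD[OF bot, of "e/2"] e by (auto simp: eventually_at_bot_linorder dist_norm)
    \<comment> \<open>The extra 1 is there because the ball is open: the points \<plusminus>(|a0| +
      |b0|) must belong to it.\<close>
    define B where "B = \<bar>a0\<bar> + \<bar>b0\<bar> + 1"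
    show ?thesis
    proof (intro exI[of _ B] conjI allI impI)
      fix a b :: real assume "ball 0 B \<subseteq> cbox a b"
      then have "cball 0 (\<bar>a0\<bar> + \<bar>b0\<bar>) \<subseteq> cbox a b"
        by (auto simp: B_def subset_eq)
      then have "\<bar>a0\<bar> + \<bar>b0\<bar> \<in> cbox a b" "- (\<bar>a0\<bar> + \<bar>b0\<bar>) \<in> cbox a b"
        by (auto simp: subset_eq)
      then have ab: "a \<le> b" "a \<le> a0" "b0 \<le> b" by auto
      show "\<exists>z. (f has_integral z) (cbox a b) \<and> norm (z - (P - N)) < e"
      proof (intro exI conjI)
        show "(f has_integral \<Phi> b - \<Phi> a) (cbox a b)"
          using fundamental_theorem_of_calculus[OF ab(1), of \<Phi> f] der
          by (simp add: has_vector_derivative_at_within)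
        have "norm ((\<Phi> b - P) - (\<Phi> a - N)) < e"
          using norm_triangle_ineq4[of "\<Phi> b - P" "\<Phi> a - N"] a0[OF ab(2)] b0[OF ab(3)] by linarith
        then show "norm (\<Phi> b - \<Phi> a - (P - N)) < e" by (simp add: algebra_simps)
      qed
    qed (simp add: B_def)
  qed
  then show ?thesis by (subst has_integral_alt) (auto simp: nb)
qed

lemma has_integral_atLeast_by_limit:
  fixes \<Phi> :: "real \<Rightarrow> 'a::banach"
  assumes der: "\<And>s. r \<le> s \<Longrightarrow> (\<Phi> has_vector_derivative f s) (at s)"
    and top: "(\<Phi> \<longlongrightarrow> P) at_top"
  shows "(f has_integral P - \<Phi> r) {r..}"
proof -
  have nb: "\<not> (\<exists>a b. {r..} = cbox a (b::real))"
    by (metis Icc_eq_Icc atLeastAtMost_iff atLeast_iff cbox_interval linorder_not_less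
        order.refl not_Ici_eq_Icc)
  have "\<exists>B>0. \<forall>a b. ball 0 B \<subseteq> cbox a b \<longrightarrow>
      (\<exists>z. ((\<lambda>x. if x \<in> {r..} then f x else 0) has_integral z) (cbox a b) \<and> norm (z - (P - \<Phi> r)) < e)"
    if e: "0 < e" for e
  proof -
    obtain b0 where b0: "\<And>b. b0 \<le> b \<Longrightarrow> norm (\<Phi> b - P) < e"
      using tendstoD[OF top, of e] e by (auto simp: eventually_at_top_linorder dist_norm)
    define B where "B = \<bar>r\<bar> + \<bar>b0\<bar> + 1"
    show ?thesis
    proof (intro exI[of _ B] conjI allI impI)
      fix a b :: real assume "ball 0 B \<subseteq> cbox a b"
      then have "cball 0 (\<bar>r\<bar> + \<bar>b0\<bar>) \<subseteq> cbox a b"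
        by (auto simp: B_def subset_eq)
      then have "\<bar>r\<bar> + \<bar>b0\<bar> \<in> cbox a b" "- (\<bar>r\<bar> + \<bar>b0\<bar>) \<in> cbox a b"
        by (auto simp: subset_eq)
      then have ab: "a \<le> r" "r \<le> b" "b0 \<le> b" by auto
      show "\<exists>z. ((\<lambda>x. if x \<in> {r..} then f x else 0) has_integral z) (cbox a b) \<and> norm (z - (P - \<Phi> r)) < e"
      proof (intro exI conjI)
        have "(f has_integral \<Phi> b - \<Phi> r) {r..b}"
          using fundamental_theorem_of_calculus[OF ab(2), of \<Phi> f] der
          by (simp add: has_vector_derivative_at_within)
        moreover have "{r..} \<inter> cbox a b = {r..b}" using ab by auto
        ultimately show "((\<lambda>x. if x \<in> {r..} then f x else 0) has_integral \<Phi> b - \<Phi> r) (cbox a b)"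
          by (simp only: has_integral_restrict_Int)
        show "norm (\<Phi> b - \<Phi> r - (P - \<Phi> r)) < e"
          using b0[OF ab(3)] by (simp add: algebra_simps)
      qed
    qed (simp add: B_def)
  qed
  then show ?thesis using nb by (subst has_integral_alt) auto
qed

text \<open>In the coordinate \<open>\<zeta>\<close> with \<open>z = exp \<zeta>\<close> the rays and the arc become the straight lines
  \<open>Im \<zeta> = \<plusminus>\<theta>\<close> and \<open>Re \<zeta> = ln r\<close>, and \<open>f z dz\<close> becomes \<open>exp \<zeta> f (exp \<zeta>) d\<zeta>\<close>.\<close>

lemma ray_arc_integral_primitive:
  fixes f :: "complex \<Rightarrow> 'a::cbanach"
  assumes "0 < r" "0 \<le> \<theta>"
    and prim: "\<And>\<zeta>. \<bar>Im \<zeta>\<bar> \<le> \<theta> \<Longrightarrow> has_cderiv G (exp \<zeta> *\<^sub>C f (exp \<zeta>)) \<zeta>"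
    and up: "((\<lambda>x. G (Complex x \<theta>)) \<longlongrightarrow> P) at_top"
    and lo: "((\<lambda>x. G (Complex x (- \<theta>))) \<longlongrightarrow> N) at_top"
  shows "ray_arc_integral r \<theta> f = P - N"
proof -
  have exp_eq: "exp (Complex (ln \<rho>) y) = of_real \<rho> * cis y" if "0 < \<rho>" for \<rho> y
    using that by (simp add: exp_eq_polar)
  have ray: "((\<lambda>\<rho>. cis y *\<^sub>C f (of_real \<rho> * cis y)) has_integral Q - G (Complex (ln r) y)) {r..}"
    if "\<bar>y\<bar> \<le> \<theta>" and lim: "((\<lambda>x. G (Complex x y)) \<longlongrightarrow> Q) at_top" for y Q
  proof (rule has_integral_atLeast_by_limit[where \<Phi> = "\<lambda>\<rho>. G (Complex (ln \<rho>) y)"])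
    show "((\<lambda>\<rho>. G (Complex (ln \<rho>) y)) \<longlongrightarrow> Q) at_top"
      by (rule filterlim_compose[OF lim ln_at_top])
    fix \<rho> assume "r \<le> \<rho>"
    then have "0 < \<rho>" using \<open>0 < r\<close> by simp
    have "((\<lambda>\<rho>. Complex (ln \<rho>) y) has_vector_derivative of_real (1 / \<rho>)) (at \<rho>)"
      using \<open>0 < \<rho>\<close> unfolding Complex_eq
      by (auto simp: has_vector_derivative_def scaleR_conv_of_real field_simps intro!: derivative_eq_intros)
    from has_vector_derivative_compose_cderiv[OF prim this]
    show "((\<lambda>\<rho>. G (Complex (ln \<rho>) y)) has_vector_derivative cis y *\<^sub>C f (of_real \<rho> * cis y)) (at \<rho>)"
      using \<open>\<bar>y\<bar> \<le> \<theta>\<close> \<open>0 < \<rho>\<close> by (simp add: exp_eq scaleC_scaleC)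
  qed
  have arc: "((\<lambda>\<psi>. (\<i> * of_real r * cis \<psi>) *\<^sub>C f (of_real r * cis \<psi>)) has_integral
      G (Complex (ln r) \<theta>) - G (Complex (ln r) (- \<theta>))) {- \<theta>..\<theta>}"
  proof (rule fundamental_theorem_of_calculus)
    fix \<psi> assume "\<psi> \<in> {- \<theta>..\<theta>}"
    have "((\<lambda>\<psi>. Complex (ln r) \<psi>) has_vector_derivative \<i>) (at \<psi> within {- \<theta>..\<theta>})"
      by (auto simp: Complex_eq has_vector_derivative_def scaleR_conv_of_real intro!: derivative_eq_intros)
    from has_vector_derivative_compose_cderiv[OF prim this]
    show "((\<lambda>\<psi>. G (Complex (ln r) \<psi>)) has_vector_derivative
       (\<i> * of_real r * cis \<psi>) *\<^sub>C f (of_real r * cis \<psi>)) (at \<psi> within {- \<theta>..\<theta>})"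
      using \<open>\<psi> \<in> _\<close> \<open>0 < r\<close> by (simp add: exp_eq scaleC_scaleC mult.assoc abs_le_iff)
  qed (use \<open>0 \<le> \<theta>\<close> in simp)
  \<comment> \<open>The values of \<open>G\<close> at the two corners
    \<open>Complex (ln r) (\<plusminus>\<theta>)\<close> cancel between the arc and the
    rays.\<close>
  show ?thesis
    unfolding ray_arc_integral_def
    using integral_unique[OF ray[OF _ lo]] integral_unique[OF ray[OF _ up]] integral_unique[OF arc] \<open>0 \<le> \<theta>\<close>
    by simp
qed

text \<open>The truncation error on {a..b} is exactly (\<Phi> b - P) - (\<Phi> a - N), and the
  common rate \<open>e\<close> bounds both terms independently of t.\<close>

lemma uniformly_convergent_integral_primitive:
  fixes \<Phi> :: "'t \<Rightarrow> real \<Rightarrow> 'a::banach"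
  assumes der: "\<And>t s. t \<in> S \<Longrightarrow> (\<Phi> t has_vector_derivative f t s) (at s)"
    and top: "\<forall>\<^sub>F s in at_top. \<forall>t\<in>S. norm (\<Phi> t s - P t) \<le> e s" "(e \<longlongrightarrow> 0) at_top"
    and bot: "\<forall>\<^sub>F s in at_bot. \<forall>t\<in>S. norm (\<Phi> t s - N t) \<le> e s" "(e \<longlongrightarrow> 0) at_bot"
  shows "uniformly_convergent_integral S f"
    and "\<And>t. t \<in> S \<Longrightarrow> integral UNIV (f t) = P t - N t"
proof -
  have I: "(f t has_integral P t - N t) UNIV" if "t \<in> S" for t
  proof (rule has_integral_UNIV_by_limits[OF der[OF that]])
    show "(\<Phi> t \<longlongrightarrow> P t) at_top"
      using that by (intro Lim_transform_bound[THEN LIM_zero_cancel, OF _ top(2)] eventually_mono[OF top(1)])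
        fastforce+
    show "(\<Phi> t \<longlongrightarrow> N t) at_bot"
      using that by (intro Lim_transform_bound[THEN LIM_zero_cancel, OF _ bot(2)] eventually_mono[OF bot(1)])
        fastforce+
  qed
  then show eq: "\<And>t. t \<in> S \<Longrightarrow> integral UNIV (f t) = P t - N t" by (rule integral_unique)
  show "uniformly_convergent_integral S f"
    unfolding uniformly_convergent_integral_def
  proof (intro conjI ballI)
    show "f t integrable_on UNIV" if "t \<in> S" for t using I[OF that] by (rule has_integral_integrable)
    show "uniform_limit S (\<lambda>(a, b) t. integral {a..b} (f t)) (\<lambda>t. integral UNIV (f t)) (at_bot \<times>\<^sub>F at_top)"
    proof (rule uniform_limitI)
      fix \<epsilon> :: real assume "0 < \<epsilon>"
      \<comment> \<open>The signs of a and b are recorded so that a \<le> b when the fundamental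
        theorem is applied.\<close>
      have "\<forall>\<^sub>F a in at_bot. (\<forall>t\<in>S. norm (\<Phi> t a - N t) < \<epsilon> / 2) \<and> a \<le> 0"
        using order_tendstoD(2)[OF bot(2) half_gt_zero[OF \<open>0 < \<epsilon>\<close>]] bot(1) eventually_le_at_bot[of 0]
        by eventually_elim (auto intro: le_less_trans)
      moreover have "\<forall>\<^sub>F b in at_top. (\<forall>t\<in>S. norm (\<Phi> t b - P t) < \<epsilon> / 2) \<and> 0 \<le> b"
        using order_tendstoD(2)[OF top(2) half_gt_zero[OF \<open>0 < \<epsilon>\<close>]] top(1) eventually_ge_at_top[of 0]
        by eventually_elim (auto intro: le_less_trans)
      ultimately have "\<forall>\<^sub>F x in at_bot \<times>\<^sub>F at_top.
          ((\<forall>t\<in>S. norm (\<Phi> t (fst x) - N t) < \<epsilon> / 2) \<and> fst x \<le> 0) \<and>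
          ((\<forall>t\<in>S. norm (\<Phi> t (snd x) - P t) < \<epsilon> / 2) \<and> 0 \<le> snd x)"
        by (rule eventually_prodI)
      then show "\<forall>\<^sub>F x in at_bot \<times>\<^sub>F at_top. \<forall>t\<in>S.
          dist ((case x of (a, b) \<Rightarrow> \<lambda>t. integral {a..b} (f t)) t) (integral UNIV (f t)) < \<epsilon>"
      proof eventually_elim
        case (elim x)
        obtain a b where x: "x = (a, b)" by fastforce
        have "dist (integral {a..b} (f t)) (integral UNIV (f t)) < \<epsilon>" if t: "t \<in> S" for t
        proof -
          have "(f t has_integral \<Phi> t b - \<Phi> t a) {a..b}"
            using elim x der[OF t]
            by (intro fundamental_theorem_of_calculus) (auto intro: has_vector_derivative_at_within)
          then have "dist (integral {a..b} (f t)) (integral UNIV (f t))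
              = norm ((\<Phi> t b - P t) - (\<Phi> t a - N t))"
            by (simp add: integral_unique eq[OF t] dist_norm algebra_simps)
          also have "\<dots> \<le> norm (\<Phi> t b - P t) + norm (\<Phi> t a - N t)"
            by (rule norm_triangle_ineq4)
          also have "\<dots> < \<epsilon> / 2 + \<epsilon> / 2"
            using elim x t by (intro add_strict_mono) auto
          finally show ?thesis by simp
        qed
        then show ?case by (simp add: x)
      qed
    qed
  qed
qed

section \<open>The resolvent of a sectorial operator\<close>

lemma resolvent_shift_inv:
  assumes op: "closed_operator D A" and res: "- w \<in> resolvent_set D A"
  shows "bij_betw (\<lambda>x. w *\<^sub>C x + A x) D UNIV"
    and "shift_inv D A w y = - resolvent D A (- w) y"
    and "bounded_linear (shift_inv D A w)"
proof -
  let ?f = "\<lambda>x. (- w) *\<^sub>C x - A x" and ?g = "\<lambda>x. w *\<^sub>C x + A x"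
  have bij: "bij_betw ?f D UNIV" and bl: "bounded_linear (resolvent D A (- w))"
    using res by (auto simp: resolvent_set_def)
  have g: "?g = uminus \<circ> ?f" by (auto simp: scaleC.minus_left)
  show bg: "bij_betw ?g D UNIV"
    unfolding g by (rule bij_betw_trans[OF bij]) (simp add: bij_uminus)
  have eq: "shift_inv D A w y = - resolvent D A (- w) y" for y
  proof -
    let ?x = "resolvent D A (- w) y"
    have x: "?x \<in> D" "?f ?x = y"
      unfolding resolvent_def using bij inv_into_into[of y ?f D] f_inv_into_f[of y ?f D]
      by (auto simp: bij_betw_def)
    have D: "- ?x \<in> D" "A (- ?x) = - A ?x"
      using op x(1) unfolding closed_operator_def by (metis scaleC_minus_one)+
    then have "?g (- ?x) = y"
      using x(2) by (simp add: scaleC.minus_left scaleC.minus_right)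
    then show ?thesis
      unfolding shift_inv_def using bg D(1) inv_into_f_f[of ?g D "- ?x"] by (simp add: bij_betw_def)
  qed
  then show "shift_inv D A w y = - resolvent D A (- w) y" .
  show "bounded_linear (shift_inv D A w)"
    using bounded_linear_minus[OF bl] eq by (metis (no_types, lifting) ext)
qed

lemma shift_inv_solves:
  assumes "closed_operator D A" "- w \<in> resolvent_set D A"
  shows "shift_inv D A w y \<in> D" "w *\<^sub>C shift_inv D A w y + A (shift_inv D A w y) = y"
    and "x \<in> D \<Longrightarrow> shift_inv D A w (w *\<^sub>C x + A x) = x"
  using resolvent_shift_inv(1)[OF assms] inv_into_into[of y "\<lambda>x. w *\<^sub>C x + A x" D]
    f_inv_into_f[of y "\<lambda>x. w *\<^sub>C x + A x" D] inv_into_f_f[of "\<lambda>x. w *\<^sub>C x + A x" D x]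
  unfolding shift_inv_def bij_betw_def by auto

lemma shift_inv_scaleC:
  assumes "closed_operator D A" "- w \<in> resolvent_set D A"
  shows "shift_inv D A w (c *\<^sub>C y) = c *\<^sub>C shift_inv D A w y"
proof -
  let ?x = "shift_inv D A w y"
  have "c *\<^sub>C ?x \<in> D" "A (c *\<^sub>C ?x) = c *\<^sub>C A ?x"
    using assms(1) shift_inv_solves(1)[OF assms] unfolding closed_operator_def by blast+
  then show ?thesis
    using shift_inv_solves(3)[OF assms, of "c *\<^sub>C ?x"] shift_inv_solves(2)[OF assms, of y]
    by (metis scaleC_add_right scaleC_scaleC mult.commute)
qed

lemma shift_inv_resolvent_identity:
  assumes op: "closed_operator D A" and "- w \<in> resolvent_set D A" "- v \<in> resolvent_set D A"
  shows "shift_inv D A w y - shift_inv D A v y = (v - w) *\<^sub>C shift_inv D A w (shift_inv D A v y)"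
proof -
  interpret S: bounded_linear "shift_inv D A w" by (rule resolvent_shift_inv(3)[OF assms(1,2)])
  let ?x = "shift_inv D A v y"
  have "w *\<^sub>C ?x + A ?x = y + (w - v) *\<^sub>C ?x"
    using shift_inv_solves(2)[OF assms(1,3), of y] by (simp add: scaleC.diff_left algebra_simps)
  then have "?x = shift_inv D A w (y + (w - v) *\<^sub>C ?x)"
    using shift_inv_solves(3)[OF assms(1,2) shift_inv_solves(1)[OF assms(1,3)], of y] by simp
  then have "?x = shift_inv D A w y + (w - v) *\<^sub>C shift_inv D A w ?x"
    by (simp add: S.add shift_inv_scaleC[OF assms(1,2)])
  then show ?thesis by (simp add: scaleC.diff_left algebra_simps)
qed

lemma sectorial_resolvent_bound:
  assumes "sectorial D A \<rho>\<^sub>s \<phi>"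
  obtains M where "0 \<le> M"
    and "\<And>w. - w \<notin> Sigma_sector \<rho>\<^sub>s \<phi> \<Longrightarrow> - w \<in> resolvent_set D A"
    and "\<And>w x. - w \<notin> Sigma_sector \<rho>\<^sub>s \<phi> \<Longrightarrow>
      norm (shift_inv D A w x) \<le> M / (1 + cmod w) * norm x"
proof -
  have op: "closed_operator D A" using assms by (simp add: sectorial_def)
  obtain M where M: "\<And>z. z \<notin> Sigma_sector \<rho>\<^sub>s \<phi> \<Longrightarrow>
        z \<in> resolvent_set D A \<and> onorm (resolvent D A z) \<le> M / (1 + cmod z)"
    using assms unfolding sectorial_def by blast
  show thesis
  proof
    \<comment> \<open>Passing to \<open>\<bar>M\<bar>\<close> secures the sign without an argument
      about \<open>M\<close>.\<close>
    show "0 \<le> \<bar>M\<bar>" by simp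
    show res: "- w \<in> resolvent_set D A" if "- w \<notin> Sigma_sector \<rho>\<^sub>s \<phi>" for w
      using M[OF that] by blast
    show "norm (shift_inv D A w x) \<le> \<bar>M\<bar> / (1 + cmod w) * norm x"
      if "- w \<notin> Sigma_sector \<rho>\<^sub>s \<phi>" for w x
    proof -
      have "bounded_linear (resolvent D A (- w))" using res[OF that] by (simp add: resolvent_set_def)
      then have "norm (shift_inv D A w x) \<le> onorm (resolvent D A (- w)) * norm x"
        by (simp add: resolvent_shift_inv(2)[OF op res[OF that]] onorm)
      also have "\<dots> \<le> \<bar>M\<bar> / (1 + cmod w) * norm x"
      proof (rule mult_right_mono)
        have "M / (1 + cmod w) \<le> \<bar>M\<bar> / (1 + cmod w)" by (intro divide_right_mono) auto
        then show "onorm (resolvent D A (- w)) \<le> \<bar>M\<bar> / (1 + cmod w)" using M[OF that] by simp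
      qed simp
      finally show ?thesis .
    qed
  qed
qed

text \<open>Two applications of the resolvent identity leave the exact remainder (v - w)^2 S_v S_w
  S_w x, which a uniform bound on V makes quadratic. The derivative is taken within V because the
  bound is available only there.\<close>

lemma has_derivative_shift_inv:
  assumes op: "closed_operator D A"
    and res: "\<And>w. w \<in> V \<Longrightarrow> - w \<in> resolvent_set D A"
    and bd: "\<And>w x. w \<in> V \<Longrightarrow> norm (shift_inv D A w x) \<le> M * norm x"
    and "w \<in> V"
  shows "((\<lambda>w. shift_inv D A w x) has_derivative
    (\<lambda>h. h *\<^sub>C (- shift_inv D A w (shift_inv D A w x)))) (at w within V)"
proof -
  let ?S = "shift_inv D A"
  interpret S: bounded_linear "?S w" by (rule resolvent_shift_inv(3)[OF op res[OF \<open>w \<in> V\<close>]])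
  have err: "?S v x - ?S w x + (v - w) *\<^sub>C ?S w (?S w x) = ((v - w) * (v - w)) *\<^sub>C ?S v (?S w (?S w x))"
    if "v \<in> V" for v
  proof -
    have "?S v x - ?S w x = (w - v) *\<^sub>C ?S v (?S w x)"
      using shift_inv_resolvent_identity[OF op res res, OF that \<open>w \<in> V\<close>] .
    moreover have "?S v (?S w x) = ?S w (?S w x) + (w - v) *\<^sub>C ?S v (?S w (?S w x))"
      using shift_inv_resolvent_identity[OF op res res, OF that \<open>w \<in> V\<close>, of "?S w x"]
      by (simp add: algebra_simps)
    moreover have "(w - v) *\<^sub>C y + (v - w) *\<^sub>C y = 0" for y :: 'a
      by (simp add: scaleC_add_left[symmetric])
    moreover have "(w - v) * (w - v) = (v - w) * (v - w)" by (simp add: algebra_simps)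
    ultimately show ?thesis by (simp add: scaleC_add_right scaleC_scaleC)
  qed
  have M: "norm (?S v (?S w (?S w x))) \<le> M * (M * (M * norm x))" if "v \<in> V" for v
  proof (cases "0 \<le> M")
    case True
    then show ?thesis
      using bd[OF that, of "?S w (?S w x)"] bd[OF \<open>w \<in> V\<close>, of "?S w x"] bd[OF \<open>w \<in> V\<close>, of x]
      by (meson mult_left_mono order_trans)
  next
    \<comment> \<open>No sign of \<open>M\<close> is assumed; a negative \<open>M\<close> forces x =
      0.\<close>
    case False
    then have "?S w (?S w x) = 0"
      using bd[OF \<open>w \<in> V\<close>, of "?S w x"] norm_ge_zero[of "?S w (?S w x)"] 
      by (metis linorder_not_le mult_neg_pos norm_le_zero_iff order_trans zero_less_norm_iff S.zero)
    moreover have "x = 0"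
      using bd[OF \<open>w \<in> V\<close>, of x] False norm_ge_zero[of "?S w x"] 
      by (metis linorder_not_le mult_neg_pos order_trans zero_less_norm_iff)
    ultimately show ?thesis
      using resolvent_shift_inv(3)[OF op res[OF that]] by (simp add: linear_0 bounded_linear.linear)
  qed
  have ev: "\<forall>\<^sub>F v in at w within V. v \<in> V" by (simp add: eventually_at_filter)
  have "((\<lambda>v. norm (?S v x - ?S w x - (v - w) *\<^sub>C (- ?S w (?S w x))) / norm (v - w)) \<longlongrightarrow> 0) (at w within V)"
  proof (rule Lim_null_comparison)
    show "((\<lambda>v. cmod (v - w) * (M * (M * (M * norm x)))) \<longlongrightarrow> 0) (at w within V)"
      by (auto intro!: tendsto_eq_intros)
    show "\<forall>\<^sub>F v in at w within V. norm (norm (?S v x - ?S w x - (v - w) *\<^sub>C (- ?S w (?S w x))) / norm (v - w))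
        \<le> cmod (v - w) * (M * (M * (M * norm x)))"
      using ev
    proof eventually_elim
      case (elim v)
      have "norm (?S v x - ?S w x - (v - w) *\<^sub>C (- ?S w (?S w x)))
          = cmod (v - w) * (cmod (v - w) * norm (?S v (?S w (?S w x))))"
        using err[OF elim] by (simp add: scaleC.minus_right norm_scaleC norm_mult)
      also have "\<dots> / norm (v - w) \<le> cmod (v - w) * norm (?S v (?S w (?S w x)))"
        by simp
      also have "\<dots> \<le> cmod (v - w) * (M * (M * (M * norm x)))"
        by (intro mult_left_mono M elim) simp
      finally show ?case by simp
    qed
  qed
  then show ?thesis
    unfolding has_derivative_iff_norm by (simp add: scaleC.bounded_linear_left)
qed

text \<open>Supplies the continuity of the derivative. In the splitting S_v (S_v x - S_w x) + S_v
  (S_w x), the first term is small by uniform boundedness and the second converges by strong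
  continuity.\<close>

lemma continuous_on_shift_inv_twice:
  assumes op: "closed_operator D A"
    and res: "\<And>w. w \<in> V \<Longrightarrow> - w \<in> resolvent_set D A"
    and bd: "\<And>w x. w \<in> V \<Longrightarrow> norm (shift_inv D A w x) \<le> M * norm x"
  shows "continuous_on V (\<lambda>w. shift_inv D A w (shift_inv D A w x))"
  unfolding continuous_on_def
proof
  let ?S = "shift_inv D A"
  fix w assume w: "w \<in> V"
  have cont: "((\<lambda>v. ?S v y) \<longlongrightarrow> ?S w y) (at w within V)" for y
    using has_derivative_continuous[OF has_derivative_shift_inv[OF assms w]]
    unfolding continuous_within .
  have ev: "\<forall>\<^sub>F v in at w within V. v \<in> V" by (simp add: eventually_at_filter)
  have "((\<lambda>v. ?S v (?S v x - ?S w x)) \<longlongrightarrow> 0) (at w within V)"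
  proof (rule Lim_null_comparison)
    show "\<forall>\<^sub>F v in at w within V. norm (?S v (?S v x - ?S w x)) \<le> M * norm (?S v x - ?S w x)"
      using ev by eventually_elim (rule bd)
    show "((\<lambda>v. M * norm (?S v x - ?S w x)) \<longlongrightarrow> 0) (at w within V)"
      using cont[of x] by (auto intro!: tendsto_eq_intros)
  qed
  moreover have "((\<lambda>v. ?S v (?S w x)) \<longlongrightarrow> ?S w (?S w x)) (at w within V)"
    by (rule cont)
  ultimately have "((\<lambda>v. ?S v (?S v x - ?S w x) + ?S v (?S w x)) \<longlongrightarrow> 0 + ?S w (?S w x)) (at w within V)"
    by (rule tendsto_add)
  moreover have "\<forall>\<^sub>F v in at w within V. ?S v (?S v x - ?S w x) + ?S v (?S w x) = ?S v (?S v x)"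
    using ev
    by eventually_elim
      (simp add: bounded_linear.linear[OF resolvent_shift_inv(3)[OF op res]] linear_diff)
  ultimately show "((\<lambda>v. ?S v (?S v x)) \<longlongrightarrow> ?S w (?S w x)) (at w within V)"
    by (simp add: filterlim_cong)
qed

text \<open>The resolvent is differentiated within the image of U under exp (c \<zeta>), which is
  enough for the chain rule; openness of U then gives a full derivative in \<zeta>.\<close>

lemma c1_on_shift_inv_exp:
  assumes op: "closed_operator D A" and "open U"
    and res: "\<And>\<zeta>. \<zeta> \<in> U \<Longrightarrow> - exp (c * \<zeta>) \<in> resolvent_set D A"
    and bd: "\<And>\<zeta> x. \<zeta> \<in> U \<Longrightarrow> norm (shift_inv D A (exp (c * \<zeta>)) x) \<le> M * norm x"
    and "c \<noteq> 0"
  shows "c1_on U (\<lambda>\<zeta>. shift_inv D A (exp (c * \<zeta>)) x)"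
proof -
  let ?S = "shift_inv D A"
  define V where "V = (\<lambda>\<zeta>. exp (c * \<zeta>)) ` U"
  have resV: "\<And>w. w \<in> V \<Longrightarrow> - w \<in> resolvent_set D A"
    and bdV: "\<And>w x. w \<in> V \<Longrightarrow> norm (?S w x) \<le> M * norm x"
    using res bd by (auto simp: V_def)
  let ?S' = "\<lambda>\<zeta>. (c * exp (c * \<zeta>)) *\<^sub>C (- ?S (exp (c * \<zeta>)) (?S (exp (c * \<zeta>)) x))"
  have "has_cderiv (\<lambda>\<zeta>. ?S (exp (c * \<zeta>)) x) (?S' \<zeta>) \<zeta>" if "\<zeta> \<in> U" for \<zeta>
  proof -
    have 1: "((\<lambda>\<zeta>. exp (c * \<zeta>)) has_derivative (\<lambda>h. h * (c * exp (c * \<zeta>)))) (at \<zeta> within U)"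
      by (auto intro!: derivative_eq_intros)
    have "((\<lambda>w. ?S w x) has_derivative (\<lambda>h. h *\<^sub>C (- ?S (exp (c * \<zeta>)) (?S (exp (c * \<zeta>)) x))))
        (at (exp (c * \<zeta>)) within V)"
      using has_derivative_shift_inv[OF op resV bdV] that unfolding V_def by blast
    from has_derivative_in_compose[OF 1 this[unfolded V_def]] show ?thesis
      unfolding has_cderiv_def at_within_open[OF that \<open>open U\<close>] by (simp add: scaleC_scaleC)
  qed
  moreover have "continuous_on U (\<lambda>\<zeta>. ?S (exp (c * \<zeta>)) (?S (exp (c * \<zeta>)) x))"
    by (rule continuous_on_compose2[OF continuous_on_shift_inv_twice[OF op resV bdV],
          where f = "\<lambda>\<zeta>. exp (c * \<zeta>)"])
      (auto simp: V_def intro!: continuous_on_exp continuous_on_mult_left)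
  then have "continuous_on U ?S'"
    by (intro scaleC.continuous_on continuous_on_minus continuous_on_mult_left continuous_on_exp
        continuous_on_id continuous_on_const)
  ultimately show ?thesis unfolding c1_on_def by (intro exI[of _ ?S']) simp
qed

section \<open>Decay on the domain of a fractional power\<close>

text \<open>The shift of the vertex by \<open>\<rho>\<^sub>s\<close> to the right puts the sector
  strictly inside the cone at 0 with the same half-angle. The cone inequality is invariant under
  positive scaling, so moduli can be cancelled.\<close>

lemma Sigma_sector_cone:
  assumes "z \<in> Sigma_sector \<rho>\<^sub>s \<phi>" "0 < \<rho>\<^sub>s" "\<phi> < pi / 2"
  shows "\<rho>\<^sub>s \<le> Re z" "0 < \<phi>" "\<bar>Im z\<bar> * cos \<phi> < Re z * sin \<phi>"
proof -
  obtain \<rho> \<theta> where z: "z = of_real \<rho>\<^sub>s + of_real \<rho> * cis \<theta>" "0 \<le> \<rho>" "\<bar>\<theta>\<bar> < \<phi>"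
    using assms(1) by (auto simp: Sigma_sector_def)
  show "0 < \<phi>" using z(3) by linarith
  have "0 < cos \<theta>" using z(3) assms(3) by (intro cos_gt_zero_pi) auto
  then show "\<rho>\<^sub>s \<le> Re z" using z by simp
  have "0 < sin \<phi>" using \<open>0 < \<phi>\<close> assms(3) by (intro sin_gt_zero) auto
  have "\<bar>sin \<theta>\<bar> = sin \<bar>\<theta>\<bar>"
    using z(3) assms(3) sin_ge_zero[of "\<bar>\<theta>\<bar>"] by (cases "0 \<le> \<theta>") auto
  then have "cos \<theta> * sin \<phi> - \<bar>sin \<theta>\<bar> * cos \<phi> = sin (\<phi> - \<bar>\<theta>\<bar>)"
    by (simp add: sin_diff cos_abs_real mult.commute)
  also have "\<dots> \<ge> 0" using z(3) assms(3) \<open>0 < \<phi>\<close> by (intro sin_ge_zero) auto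
  finally have "\<rho> * (\<bar>sin \<theta>\<bar> * cos \<phi>) \<le> \<rho> * (cos \<theta> * sin \<phi>)"
    using z(2) by (intro mult_left_mono) auto
  moreover have "0 < \<rho>\<^sub>s * sin \<phi>" using assms(2) \<open>0 < sin \<phi>\<close> by simp
  moreover have "\<bar>Im z\<bar> = \<rho> * \<bar>sin \<theta>\<bar>" "Re z = \<rho>\<^sub>s + \<rho> * cos \<theta>"
    using z by (simp_all add: abs_mult)
  ultimately show "\<bar>Im z\<bar> * cos \<phi> < Re z * sin \<phi>"
    by (simp add: distrib_right mult.assoc)
qed

text \<open>The direction of - exp w makes an angle \<pi> - |Im w| > \<phi> with the positive axis.
  In the cone inequality this appears as sin (|Im w| + \<phi>) < 0, impossible for an angle in
  [0, \<pi>].\<close>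

lemma neg_exp_notin_Sigma_sector:
  assumes "0 < \<rho>\<^sub>s" "\<phi> < pi / 2" "\<bar>Im w\<bar> < pi - \<phi>"
  shows "- exp w \<notin> Sigma_sector \<rho>\<^sub>s \<phi>"
proof
  assume "- exp w \<in> Sigma_sector \<rho>\<^sub>s \<phi>"
  from Sigma_sector_cone[OF this assms(1,2)]
  have "0 < \<phi>" and "\<bar>Im (- exp w)\<bar> * cos \<phi> < Re (- exp w) * sin \<phi>" by auto
  then have "exp (Re w) * (\<bar>sin (Im w)\<bar> * cos \<phi>) < exp (Re w) * (- cos (Im w) * sin \<phi>)"
    by (simp add: Re_exp Im_exp abs_mult mult.assoc)
  then have "\<bar>sin (Im w)\<bar> * cos \<phi> < - cos (Im w) * sin \<phi>"
    by (simp only: mult_less_cancel_left_pos exp_gt_zero)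
  moreover have "sin \<bar>Im w\<bar> \<le> \<bar>sin (Im w)\<bar>" by (cases "0 \<le> Im w") auto
  then have "sin \<bar>Im w\<bar> * cos \<phi> \<le> \<bar>sin (Im w)\<bar> * cos \<phi>"
    using \<open>0 < \<phi>\<close> assms(2) by (intro mult_right_mono cos_ge_zero) auto
  ultimately have "sin (\<bar>Im w\<bar> + \<phi>) < 0"
    by (simp add: sin_add cos_abs_real)
  moreover have "0 \<le> sin (\<bar>Im w\<bar> + \<phi>)"
    using assms(3) \<open>0 < \<phi>\<close> by (intro sin_ge_zero) auto
  ultimately show False by simp
qed

text \<open>Majorant for the Dunford integral. The right tail is compared with \<eta>^e, and the
  left tail is its reflection because the modulus is even in \<eta>.\<close>

lemma integrable_vertical_line_powr:
  assumes "0 < c" "e < - 1"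
  shows "(\<lambda>\<eta>. cmod (Complex c \<eta>) powr e) integrable_on UNIV"
proof -
  let ?f = "\<lambda>\<eta>. cmod (Complex c \<eta>) powr e"
  have pos: "0 < cmod (Complex c \<eta>)" for \<eta> using \<open>0 < c\<close> by (simp add: complex_eq_iff)
  have cont: "continuous_on X ?f" for X
    using pos unfolding Complex_eq by (intro continuous_intros) (auto simp: Complex_eq[symmetric] complex_eq_iff)
  have 1: "?f integrable_on {1..}"
  proof (rule measurable_bounded_by_integrable_imp_integrable_real)
    show "(\<lambda>\<eta>. \<eta> powr e) integrable_on {1..}"
      using has_integral_powr_to_inf[OF \<open>e < -1\<close>, of 1] by (auto simp: integrable_on_def)
    show "\<bar>?f \<eta>\<bar> \<le> \<eta> powr e" if "\<eta> \<in> {1..}" for \<eta>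
      using that abs_Im_le_cmod[of "Complex c \<eta>"] \<open>e < -1\<close> by (auto intro!: powr_mono2')
  qed (auto intro: continuous_imp_measurable_on_sets_lebesgue cont)
  have "?f absolutely_integrable_on {1..}" by (rule nonnegative_absolutely_integrable_1[OF 1]) simp
  moreover have "?f (- \<eta>) = ?f \<eta>" for \<eta> by (simp add: cmod_def)
  ultimately have "(\<lambda>\<eta>. ?f (- \<eta>)) absolutely_integrable_on {1..}" by simp
  then have "?f absolutely_integrable_on {.. -1}"
    using has_absolute_integral_reflect_real[of "{1..}" "{.. -1}" ?f] by (force simp: image_iff)
  then have 2: "?f integrable_on {.. -1}" by (rule set_lebesgue_integral_eq_integral(1))
  have 3: "?f integrable_on {-1..1}" by (intro integrable_continuous_real cont)
  have 4: "?f integrable_on {-1..}"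
    by (rule integrable_Un'[OF 3 1]) auto
  have "negligible ({.. -1} \<inter> {-1 :: real..})"
    by (rule negligible_subset[OF negligible_sing[of "-1"]]) auto
  moreover have "UNIV = {.. -1} \<union> {-1 :: real..}" by auto
  ultimately show ?thesis by (rule integrable_Un'[OF 2 4])
qed

text \<open>On the range of \<open>A\<^sup>-\<^sup>\<gamma>\<close> the bound \<open>\<parallel>w (wI + A)\<^sup>-\<^sup>1 x - x\<parallel> = O(1)\<close> improves to a power of \<open>1 / \<bar>w\<bar>\<close>:
  apply the operator under the Dunford integral, where the resolvent identity gains \<open>1 / \<bar>v - w\<bar>\<close>
  for small \<open>v\<close>.  For \<open>v\<close> comparable to \<open>w\<close> that factor may be singular, and the bound of
  the resolvent at \<open>v\<close> is used instead.\<close>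

lemma shift_inv_defect_bound:
  assumes op: "closed_operator D A" and "0 \<le> M"
    and res: "- w \<in> resolvent_set D A" "- v \<in> resolvent_set D A"
    and bdw: "\<And>x. norm (shift_inv D A w x) \<le> M / (1 + cmod w) * norm x"
    and bdv: "\<And>x. norm (shift_inv D A v x) \<le> M / (1 + cmod v) * norm x"
    and "w \<noteq> 0" "v \<noteq> 0" "0 < \<delta>" "\<delta> < 1"
  shows "norm (w *\<^sub>C shift_inv D A w (shift_inv D A v y) - shift_inv D A v y)
    \<le> 2 * (M + 1)\<^sup>2 * norm y * (2 / cmod w) powr \<delta> * cmod v powr (\<delta> - 1)"
    (is "norm ?d \<le> _")
proof -
  let ?S = "shift_inv D A"
  have bd1: "cmod u * norm (?S u x) \<le> M * norm x"
    if "\<And>x. norm (?S u x) \<le> M / (1 + cmod u) * norm x" for u x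
  proof -
    have "cmod u * norm (?S u x) \<le> cmod u * (M / (1 + cmod u) * norm x)"
      by (intro mult_left_mono that) simp
    also have "\<dots> = M * norm x * (cmod u / (1 + cmod u))" by simp
    also have "\<dots> \<le> M * norm x * 1"
      using \<open>0 \<le> M\<close> by (intro mult_left_mono) (auto simp: divide_simps add_pos_nonneg)
    finally show ?thesis by simp
  qed
  have wv: "0 < cmod w" "0 < cmod v" using \<open>w \<noteq> 0\<close> \<open>v \<noteq> 0\<close> by auto
  \<comment> \<open>One constant that dominates the constants of both cases below.\<close>
  have M2: "2 * M \<le> 2 * (M + 1)\<^sup>2" "(M + 1) * M \<le> 2 * (M + 1)\<^sup>2"
    using \<open>0 \<le> M\<close> by (auto simp: power2_eq_square algebra_simps)
  \<comment> \<open>The threshold 1/2 ensures |v - w| \<ge> |w| / 2 in the first case.\<close>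
  consider "cmod v \<le> cmod w / 2" | "cmod w / 2 < cmod v" by linarith
  then show ?thesis
  proof cases
    case 1
    \<comment> \<open>The factor v - w collapses the product of two resolvents, leaving two terms
      each bounded by M |y|.\<close>
    have "(v - w) *\<^sub>C ?d = w *\<^sub>C ?S w y - v *\<^sub>C ?S v y"
    proof -
      have "(v - w) *\<^sub>C ?d = w *\<^sub>C ((v - w) *\<^sub>C ?S w (?S v y)) - (v - w) *\<^sub>C ?S v y"
        by (simp add: scaleC.diff_right scaleC_scaleC mult.commute)
      also have "(v - w) *\<^sub>C ?S w (?S v y) = ?S w y - ?S v y"
        using shift_inv_resolvent_identity[OF op res] by simp
      finally show ?thesis by (simp add: scaleC.diff_right scaleC.diff_left)
    qed
    then have "cmod (v - w) * norm ?d = norm (w *\<^sub>C ?S w y - v *\<^sub>C ?S v y)"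
      by (metis norm_scaleC)
    also have "\<dots> \<le> cmod w * norm (?S w y) + cmod v * norm (?S v y)"
      using norm_triangle_ineq4[of "w *\<^sub>C ?S w y" "v *\<^sub>C ?S v y"] by (simp add: norm_scaleC)
    also have "\<dots> \<le> 2 * M * norm y" using bd1[OF bdw, of y] bd1[OF bdv, of y] by simp
    also have "\<dots> \<le> 2 * (M + 1)\<^sup>2 * norm y" using M2 by (intro mult_right_mono) auto
    finally have "cmod (v - w) * norm ?d \<le> 2 * (M + 1)\<^sup>2 * norm y" .
    moreover have "cmod w / 2 \<le> cmod (v - w)"
      using 1 norm_triangle_ineq2[of w v] by (simp add: norm_minus_commute)
    then have "cmod w / 2 * norm ?d \<le> cmod (v - w) * norm ?d" by (intro mult_right_mono) auto
    ultimately have "norm ?d \<le> 2 * (M + 1)\<^sup>2 * norm y * (2 / cmod w)"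
      using wv by (simp add: field_simps)
    also have "\<dots> \<le> 2 * (M + 1)\<^sup>2 * norm y * ((2 / cmod w) powr \<delta> * cmod v powr (\<delta> - 1))"
    proof (rule mult_left_mono)
      \<comment> \<open>Only the power \<delta> of 1/|w| is kept; the remaining 1 - \<delta> is
        traded for |v| through |v| \<le> |w| / 2.\<close>
      have "2 / cmod w = (2 / cmod w) powr \<delta> * (2 / cmod w) powr (1 - \<delta>)"
        using wv by (simp add: powr_add[symmetric])
      also have "(2 / cmod w) powr (1 - \<delta>) = (cmod w / 2) powr (\<delta> - 1)"
        using wv powr_minus_divide[of "cmod w / 2" "1 - \<delta>"] by (simp add: powr_divide)
      also have "\<dots> \<le> cmod v powr (\<delta> - 1)"
        using 1 wv \<open>\<delta> < 1\<close> by (intro powr_mono2') auto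
      finally show "2 / cmod w \<le> (2 / cmod w) powr \<delta> * cmod v powr (\<delta> - 1)"
        by (simp add: mult_left_mono)
    qed simp
    finally show ?thesis by (simp add: mult.assoc)
  next
    case 2
    have "norm ?d \<le> cmod w * norm (?S w (?S v y)) + norm (?S v y)"
      using norm_triangle_ineq4[of "w *\<^sub>C ?S w (?S v y)" "?S v y"] by (simp add: norm_scaleC)
    also have "\<dots> \<le> (M + 1) * norm (?S v y)" using bd1[OF bdw, of "?S v y"] by (simp add: algebra_simps)
    also have "\<dots> \<le> (M + 1) * (M * norm y / cmod v)"
      using bd1[OF bdv, of y] wv \<open>0 \<le> M\<close> by (intro mult_left_mono) (auto simp: field_simps)
    also have "\<dots> = (M + 1) * M * norm y * (1 / cmod v)" by simp
    also have "\<dots> \<le> 2 * (M + 1)\<^sup>2 * norm y * (1 / cmod v)"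
      using M2 by (intro mult_right_mono) auto
    also have "\<dots> \<le> 2 * (M + 1)\<^sup>2 * norm y * ((2 / cmod w) powr \<delta> * cmod v powr (\<delta> - 1))"
    proof (rule mult_left_mono)
      \<comment> \<open>The opposite trade: the power \<delta> of 1/|v| passes to w, since |w| / 2 <
        |v|.\<close>
      have "1 / cmod v = cmod v powr (- \<delta>) * cmod v powr (\<delta> - 1)"
        using wv by (simp add: powr_add[symmetric] powr_neg_one)
      also have "cmod v powr (- \<delta>) = (1 / cmod v) powr \<delta>"
        using wv by (simp add: powr_minus_divide powr_divide)
      also have "\<dots> \<le> (2 / cmod w) powr \<delta>"
        using 2 wv \<open>0 < \<delta>\<close> by (intro powr_mono2) (auto simp: field_simps)
      finally show "1 / cmod v \<le> (2 / cmod w) powr \<delta> * cmod v powr (\<delta> - 1)"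
        by (simp add: mult_right_mono)
    qed simp
    finally show ?thesis by (simp add: mult.assoc)
  qed
qed

text \<open>In the defect bound, w enters only through (2 / |w|)^\<delta>, which comes out of the
  Dunford integral. What remains is |z|^(- \<gamma>) |z|^(\<delta> - 1) on the vertical line,
  integrable because \<delta> < \<gamma>.\<close>

lemma frac_power_domain_decay:
  assumes sec: "sectorial D A \<rho>\<^sub>s \<phi>" and "0 < \<gamma>" and u: "u \<in> frac_power_domain D A \<rho>\<^sub>s \<gamma>"
  obtains C \<delta> where "0 < \<delta>" "0 \<le> C"
    and "\<And>w. w \<noteq> 0 \<Longrightarrow> - w \<notin> Sigma_sector \<rho>\<^sub>s \<phi> \<Longrightarrow>
      norm (w *\<^sub>C shift_inv D A w u - u) \<le> C * cmod w powr (- \<delta>)"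
proof -
  let ?S = "shift_inv D A"
  have op: "closed_operator D A" and \<rho>: "0 < \<rho>\<^sub>s" and \<phi>: "\<phi> < pi / 2"
    using sec by (auto simp: sectorial_def)
  obtain M where M: "0 \<le> M"
    and res: "\<And>w. - w \<notin> Sigma_sector \<rho>\<^sub>s \<phi> \<Longrightarrow> - w \<in> resolvent_set D A"
    and bd: "\<And>w x. - w \<notin> Sigma_sector \<rho>\<^sub>s \<phi> \<Longrightarrow> norm (?S w x) \<le> M / (1 + cmod w) * norm x"
    using sectorial_resolvent_bound[OF sec] by blast
  \<comment> \<open>This is half of the minimum, hence strictly below \<gamma> for integrability and
    below 1 for the defect bound.\<close>
  define \<delta> where "\<delta> = min \<gamma> 1 / 2"
  have \<delta>: "0 < \<delta>" "\<delta> < 1" "\<delta> < \<gamma>" using \<open>0 < \<gamma>\<close> by (auto simp: \<delta>_def)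
  obtain x where x: "u = neg_frac_power D A \<rho>\<^sub>s \<gamma> x"
    using u by (auto simp: frac_power_domain_def)
  define z where "z = (\<lambda>\<eta>. Complex (\<rho>\<^sub>s / 2) \<eta>)"
  define g where "g = (\<lambda>\<eta>. (z \<eta> powr (- of_real \<gamma>) * \<i>) *\<^sub>C resolvent D A (z \<eta>) x)"
  define c :: complex where "c = - (1 / (2 * of_real pi * \<i>))"
  have u_eq: "u = c *\<^sub>C integral UNIV g"
    by (simp add: x neg_frac_power_def g_def z_def c_def Let_def scaleC.minus_left)
  have z: "z \<eta> \<notin> Sigma_sector \<rho>\<^sub>s \<phi>" "z \<eta> \<noteq> 0" for \<eta>
    using Sigma_sector_cone(1)[OF _ \<rho> \<phi>, of "z \<eta>"] \<rho> by (auto simp: z_def complex_eq_iff)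
  define J where "J = integral UNIV (\<lambda>\<eta>. cmod (z \<eta>) powr (\<delta> - 1 - \<gamma>))"
  have intJ: "(\<lambda>\<eta>. cmod (z \<eta>) powr (\<delta> - 1 - \<gamma>)) integrable_on UNIV"
    unfolding z_def using \<rho> \<delta> by (intro integrable_vertical_line_powr) auto
  define C where "C = 2 * (M + 1)\<^sup>2 * norm x * 2 powr \<delta> * J"
  have "0 \<le> J" unfolding J_def by (rule integral_nonneg[OF intJ]) simp
  then have "0 \<le> C" using M by (simp add: C_def)
  show thesis
  proof (rule that[OF \<open>0 < \<delta>\<close> \<open>0 \<le> C\<close>])
    fix w assume w: "w \<noteq> 0" "- w \<notin> Sigma_sector \<rho>\<^sub>s \<phi>"
    define T where "T = (\<lambda>y. w *\<^sub>C ?S w y - y)"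
    note blS = resolvent_shift_inv(3)[OF op res[OF w(2)]]
    have blT: "bounded_linear T"
      unfolding T_def
      by (intro bounded_linear_sub bounded_linear_ident
          bounded_linear_compose[OF scaleC.bounded_linear_right blS])
    have Tc: "T (b *\<^sub>C y) = b *\<^sub>C T y" for b y
      by (simp add: T_def shift_inv_scaleC[OF op res[OF w(2)]] scaleC.diff_right scaleC_scaleC mult.commute)
    show "norm (w *\<^sub>C ?S w u - u) \<le> C * cmod w powr (- \<delta>)"
    proof (cases "g integrable_on UNIV")
      case False
      \<comment> \<open>A non-integrable function has integral 0 by default, and the estimate is
        trivial for u = 0.\<close>
      then have "u = 0" by (simp add: u_eq not_integrable_integral)
      then show ?thesis
        using \<open>0 \<le> C\<close> bounded_linear.linear[OF blT] linear_0[of T] by (simp add: T_def)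
    next
      case True
      let ?K = "2 * (M + 1)\<^sup>2 * norm x * (2 / cmod w) powr \<delta>"
      have Tg: "norm (T (g \<eta>)) \<le> ?K * cmod (z \<eta>) powr (\<delta> - 1 - \<gamma>)" for \<eta>
      proof -
        \<comment> \<open>The Dunford integrand contains (zI - A)^(-1), so the defect bound is
          applied at v = - z.\<close>
        have v: "- (- z \<eta>) \<notin> Sigma_sector \<rho>\<^sub>s \<phi>" "- z \<eta> \<noteq> 0" using z by auto
        have "resolvent D A (z \<eta>) x = - ?S (- z \<eta>) x"
          using resolvent_shift_inv(2)[OF op res[OF v(1)], of x] by simp
        then have "T (g \<eta>) = - ((z \<eta> powr (- of_real \<gamma>) * \<i>) *\<^sub>C T (?S (- z \<eta>) x))"
          by (simp add: g_def scaleC.minus_right Tc linear_neg[OF bounded_linear.linear[OF blT]])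
        then have "norm (T (g \<eta>)) = cmod (z \<eta>) powr (- \<gamma>) * norm (T (?S (- z \<eta>) x))"
          using norm_powr_real_powr'[of "- of_real \<gamma>" "z \<eta>"] by (simp add: norm_scaleC norm_mult)
        also have "\<dots> \<le> cmod (z \<eta>) powr (- \<gamma>) * (?K * cmod (- z \<eta>) powr (\<delta> - 1))"
          unfolding T_def
          by (intro mult_left_mono
              shift_inv_defect_bound[OF op M res[OF w(2)] res[OF v(1)] bd[OF w(2)] bd[OF v(1)] w(1) v(2) \<delta>(1,2)])
            simp
        also have "\<dots> = ?K * (cmod (z \<eta>) powr (- \<gamma>) * cmod (z \<eta>) powr (\<delta> - 1))" by simp
        also have "cmod (z \<eta>) powr (- \<gamma>) * cmod (z \<eta>) powr (\<delta> - 1) = cmod (z \<eta>) powr (\<delta> - 1 - \<gamma>)"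
          by (simp add: powr_add[symmetric])
        finally show ?thesis .
      qed
      have "norm (integral UNIV (\<lambda>\<eta>. T (g \<eta>))) \<le> integral UNIV (\<lambda>\<eta>. ?K * cmod (z \<eta>) powr (\<delta> - 1 - \<gamma>))"
        using integrable_linear[OF True blT] Tg integrable_cmul[OF intJ, of ?K]
        by (intro Henstock_Kurzweil_Integration.integral_norm_bound_integral) (auto simp: o_def)
      also have "\<dots> = ?K * J" by (simp add: J_def)
      also have "\<dots> = C * cmod w powr (- \<delta>)"
        by (simp add: C_def powr_divide powr_minus_divide)
      finally have "norm (T (integral UNIV g)) \<le> C * cmod w powr (- \<delta>)"
        using integral_linear[OF True blT] by (simp add: o_def)
      moreover have "norm (T u) \<le> norm (T (integral UNIV g))"
      proof -
        \<comment> \<open>The Dunford prefactor 1 / (2 \<pi>) is estimated by 1, which is why it is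
          absent from \<open>C\<close>.\<close>
        have "cmod c \<le> 1" using pi_gt3 by (simp add: c_def norm_divide norm_mult divide_simps)
        then show ?thesis
          by (simp add: u_eq Tc norm_scaleC mult_left_le_one_le)
      qed
      ultimately show ?thesis by (simp add: T_def)
    qed
  qed
qed

section \<open>The scalar integral of exp (z t) / z\<close>

text \<open>In the coordinate \<open>\<zeta>\<close> the scalar integral of \<open>exp (z t) / z\<close> has the \<open>2\<pi>\<i>\<close>-periodic integrand
  \<open>exp (t exp \<zeta>)\<close>.  Its primitive has one limit in the half-strip \<open>\<theta> \<le> Im \<zeta> \<le> 2\<pi> - \<theta>\<close>, so the two ends
  \<open>Im \<zeta> = \<plusminus>\<theta>\<close> differ by the increment over a period, found by letting \<open>Re \<zeta> \<rightarrow> -\<infinity>\<close>.\<close>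

lemma exp_exp_primitive:
  assumes "0 < t" "pi / 2 < \<theta>" "\<theta> \<le> pi"
  obtains E P N where "\<And>\<zeta>. has_cderiv E (exp (of_real t * exp \<zeta>)) \<zeta>"
    and "((\<lambda>x. E (Complex x \<theta>)) \<longlongrightarrow> P) at_top" "((\<lambda>x. E (Complex x (- \<theta>))) \<longlongrightarrow> N) at_top"
    and "P - N = 2 * of_real pi * \<i>"
proof -
  let ?h = "\<lambda>\<zeta>. exp (of_real t * exp \<zeta>) :: complex"
  have "c1_on UNIV ?h" by (intro c1_on_exp c1_on_cmult c1_on_ident)
  then obtain E where E: "\<And>\<zeta>. has_cderiv E (?h \<zeta>) \<zeta>"
    using c1_on_primitive[of UNIV ?h] by auto
  define k where "k = - t * cos \<theta>"
  have "cos \<theta> < 0" using assms by (intro cos_lt_zero_pi) auto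
  then have "0 < k" using \<open>0 < t\<close> by (simp add: k_def mult_less_0_iff)
  \<comment> \<open>On this band cos (Im z) \<le> cos \<theta> < 0, so the decay is doubly
    exponential; the crude estimate exp (- x) \<le> 1 / x with x = k exp (Re z) already gives decay
    rate 1.\<close>
  have bound: "norm (?h z) \<le> 1 / k * exp (- 1 * Re z)" if "Im z \<in> {\<theta>..2 * pi - \<theta>}" for z
  proof -
    have "cos (Im z) \<le> cos \<theta>"
    proof (cases "Im z \<le> pi")
      case True
      then show ?thesis using that assms by (intro cos_monotone_0_pi_le) auto
    next
      case False
      then have "cos (2 * pi - Im z) \<le> cos \<theta>" using that assms by (intro cos_monotone_0_pi_le) auto
      then show ?thesis by (simp add: cos_diff)
    qed
    then have "t * exp (Re z) * cos (Im z) \<le> t * exp (Re z) * cos \<theta>"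
      using \<open>0 < t\<close> by (intro mult_left_mono) auto
    then have "norm (?h z) \<le> exp (- (k * exp (Re z)))"
      by (simp add: norm_exp_eq_Re Re_exp k_def mult_ac)
    also have "\<dots> \<le> 1 / k * exp (- Re z)"
    proof -
      have "k * exp (Re z) \<le> exp (k * exp (Re z))"
        using exp_ge_add_one_self[of "k * exp (Re z)"] by linarith
      then show ?thesis using \<open>0 < k\<close> by (simp add: exp_minus divide_simps mult.commute)
    qed
    finally show ?thesis by simp
  qed
  obtain L where L: "\<And>z. 0 \<le> Re z \<Longrightarrow> Im z \<in> {\<theta>..2 * pi - \<theta>} \<Longrightarrow>
      norm (E z - L) \<le> 1 / k * (2 * pi - \<theta> - \<theta> + 1 / 1) * exp (- 1 * Re z)"
    using primitive_limit_at_end[of 1 \<theta> "2 * pi - \<theta>" E ?h "1 / k"] E bound assms by auto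
  have lim: "((\<lambda>x. E (Complex x y)) \<longlongrightarrow> L) at_top" if "y \<in> {\<theta>..2 * pi - \<theta>}" for y
    using L[of "Complex _ y"] that by (intro tendsto_by_exp_bound[of 1 _ _ "1 / k * (2 * pi - \<theta> - \<theta> + 1 / 1)"]) auto
  obtain c where c: "\<And>z. E (z + 2 * of_real pi * \<i>) - E z = c"
  proof -
    have "((\<lambda>z. E (z + 2 * of_real pi * \<i>) - E z) has_field_derivative 0) (at z)" for z
    proof -
      have 1: "(E has_field_derivative ?h z) (at (z + 2 * of_real pi * \<i>))"
        using E[of "z + 2 * of_real pi * \<i>"] by (simp add: has_cderiv_complex exp_add)
      have 2: "(E has_field_derivative ?h z) (at z)"
        using E[of z] by (simp add: has_cderiv_complex)
      have "((\<lambda>z. z + 2 * of_real pi * \<i>) has_field_derivative 1) (at z)"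
        by (auto intro!: derivative_eq_intros)
      from DERIV_diff[OF DERIV_chain2[OF 1 this] 2] show ?thesis by simp
    qed
    then show thesis
      using has_field_derivative_zero_constant[of UNIV "\<lambda>z. E (z + 2 * of_real pi * \<i>) - E z"] that by auto
  qed
  \<comment> \<open>The period increment \<open>c\<close> is the same on every vertical line, so one
    line far enough to the left suffices for each \<epsilon>. There E z - z has the small derivative
    ?h z - 1, and z itself increases by 2 \<pi> i.\<close>
  have small: "norm (c - 2 * of_real pi * \<i>) \<le> \<epsilon> * (2 * pi)" if "0 < \<epsilon>" for \<epsilon>
  proof -
    have "isCont (exp :: complex \<Rightarrow> complex) 0" by simp
    then obtain d where d: "0 < d" "\<And>u::complex. norm u < d \<Longrightarrow> norm (exp u - 1) < \<epsilon>"
      using \<open>0 < \<epsilon>\<close> unfolding continuous_at_eps_delta by (auto simp: dist_norm)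
    define x where "x = ln (d / (2 * t))"
    have x: "t * exp x < d" using d(1) \<open>0 < t\<close> by (simp add: x_def)
    have "norm ((\<lambda>z. E z - z) (Complex x (2 * pi)) - (\<lambda>z. E z - z) (Complex x 0))
        \<le> \<epsilon> * norm (Complex x (2 * pi) - Complex x 0)"
    proof (rule field_differentiable_bound)
      show "convex {z. Re z = x}"
        by (simp add: convex_def distrib_right[symmetric])
      show "((\<lambda>z. E z - z) has_field_derivative ?h z - 1) (at z within {z. Re z = x})" for z
        using E[of z] by (auto simp: has_cderiv_complex intro!: derivative_eq_intros
            intro: has_field_derivative_at_within)
      show "cmod (?h z - 1) \<le> \<epsilon>" if "z \<in> {z. Re z = x}" for z
        using d(2)[of "of_real t * exp z"] x that \<open>0 < t\<close> by (simp add: norm_mult less_imp_le)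
    qed auto
    moreover have "E (Complex x (2 * pi)) - E (Complex x 0) = c"
      using c[of "Complex x 0"] by (simp add: Complex_eq mult.commute)
    moreover have "Complex x (2 * pi) - Complex x 0 = 2 * of_real pi * \<i>"
      by (simp add: complex_eq_iff)
    ultimately show ?thesis
      by (simp add: algebra_simps norm_mult)
  qed
  have "norm (c - 2 * of_real pi * \<i>) \<le> 0"
  proof (rule field_le_epsilon)
    fix e :: real assume "0 < e"
    then show "norm (c - 2 * of_real pi * \<i>) \<le> 0 + e" using small[of "e / (2 * pi)"] by simp
  qed
  then have c_eq: "c = 2 * of_real pi * \<i>" by simp
  have "((\<lambda>x. E (Complex x (2 * pi - \<theta>)) - c) \<longlongrightarrow> L - c) at_top"
    using assms by (intro tendsto_intros lim) auto
  moreover have "E (Complex x (2 * pi - \<theta>)) - c = E (Complex x (- \<theta>))" for x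
    using c[of "Complex x (- \<theta>)"] by (simp add: Complex_eq algebra_simps)
  ultimately have "((\<lambda>x. E (Complex x (- \<theta>))) \<longlongrightarrow> L - c) at_top" by simp
  moreover have "((\<lambda>x. E (Complex x \<theta>)) \<longlongrightarrow> L) at_top" using assms by (intro lim) auto
  ultimately show thesis using that[of E L "L - c"] E c_eq by simp
qed

section \<open>The hyperbola\<close>

lemma hyperbola_has_vector_derivative:
  "(hyperbola a\<^sub>0 a b has_vector_derivative hyperbola' a b \<xi>) (at \<xi>)"
  unfolding hyperbola_def hyperbola'_def has_vector_derivative_def
  by (auto intro!: derivative_eq_intros simp: scaleR_conv_of_real algebra_simps)

lemma hyperbola_uminus: "hyperbola a\<^sub>0 a b (- \<xi>) = cnj (hyperbola a\<^sub>0 a b \<xi>)"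
  by (simp add: hyperbola_def complex_eq_iff)

text \<open>\<open>- a + \<i> b = K exp (\<i> \<omega>)\<close>, so the branches have the asymptotic directions \<open>\<plusminus>\<omega>\<close>, and \<open>\<omega>\<close>
  bisects \<open>\<pi>/2\<close> and \<open>\<phi>\<^sub>s\<close>.\<close>

context
  fixes a\<^sub>0 a b \<phi>\<^sub>s \<omega> K :: real
  assumes a\<^sub>0: "0 < a\<^sub>0" and \<phi>\<^sub>s: "pi / 2 < \<phi>\<^sub>s" "\<phi>\<^sub>s \<le> pi" and \<omega>: "\<omega> = \<phi>\<^sub>s / 2 + pi / 4"
    and a: "a = a\<^sub>0 / cos \<phi>\<^sub>s * cos \<omega>" and b: "b = - (a\<^sub>0 / cos \<phi>\<^sub>s * sin \<omega>)"
    and K: "K = - (a\<^sub>0 / cos \<phi>\<^sub>s)"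
begin

lemma cos_sector_angle_neg: "cos \<phi>\<^sub>s < 0"
  using \<phi>\<^sub>s by (intro cos_lt_zero_pi) auto

lemma hyperbola_scale_pos: "0 < K"
  using a\<^sub>0 cos_sector_angle_neg by (simp add: K divide_less_0_iff)

lemma hyperbola_params: "a = - K * cos \<omega>" "b = K * sin \<omega>" "a\<^sub>0 = - K * cos \<phi>\<^sub>s"
  using cos_sector_angle_neg by (auto simp: a b K)

lemma hyperbola_angle_bounds: "pi / 2 < \<omega>" "\<omega> < \<phi>\<^sub>s" "\<omega> < pi" "0 < sin \<omega>"
  using \<phi>\<^sub>s by (auto simp: \<omega> intro!: sin_gt_zero)

text \<open>Im z cos \<open>\<phi>\<^sub>s\<close> - Re z sin \<open>\<phi>\<^sub>s\<close> equals
  |z| sin (Arg z - \<open>\<phi>\<^sub>s\<close>), so its sign locates z relative to the ray at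
  angle \<open>\<phi>\<^sub>s\<close>; as 0 < Arg z < \<pi>, a negative sine puts Arg z below
  it.\<close>

lemma hyperbola_upper:
  assumes "0 < \<xi>"
  shows "0 < Im (hyperbola a\<^sub>0 a b \<xi>)" "Arg (hyperbola a\<^sub>0 a b \<xi>) < \<phi>\<^sub>s"
proof -
  let ?z = "hyperbola a\<^sub>0 a b \<xi>"
  have b_pos: "0 < b" using hyperbola_scale_pos hyperbola_angle_bounds by (simp add: hyperbola_params)
  then show Im: "0 < Im ?z" using assms by (simp add: hyperbola_def)
  have s: "0 \<le> sin \<phi>\<^sub>s" using \<phi>\<^sub>s by (intro sin_ge_zero) auto
  have cos_le: "cos \<phi>\<^sub>s \<le> cos \<omega>"
    using hyperbola_angle_bounds \<phi>\<^sub>s by (intro cos_monotone_0_pi_le) auto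
  have cos_neg: "cos \<omega> < 0" using hyperbola_angle_bounds by (intro cos_lt_zero_pi) auto
  have "0 < sin (\<phi>\<^sub>s - \<omega>)" using hyperbola_angle_bounds \<phi>\<^sub>s by (intro sin_gt_zero) auto
  then have 1: "0 < sinh \<xi> * (sin \<phi>\<^sub>s * cos \<omega> - cos \<phi>\<^sub>s * sin \<omega>)" using assms by (simp add: sin_diff)
  have "- cos \<omega> * exp (- \<xi>) \<le> - cos \<omega>"
    using cos_neg assms by (intro mult_left_le) auto
  then have 2: "0 \<le> sin \<phi>\<^sub>s * (cos \<omega> * exp (- \<xi>) - cos \<phi>\<^sub>s)"
    using s cos_le by (intro mult_nonneg_nonneg) auto
  have "Im ?z * cos \<phi>\<^sub>s - Re ?z * sin \<phi>\<^sub>s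
      = K * (cos \<phi>\<^sub>s * sin \<omega> * sinh \<xi> + cos \<phi>\<^sub>s * sin \<phi>\<^sub>s - cos \<omega> * sin \<phi>\<^sub>s * cosh \<xi>)"
    by (simp add: hyperbola_def hyperbola_params algebra_simps)
  \<comment> \<open>Splits off the asymptote: the sinh terms combine to sin
    (\<open>\<phi>\<^sub>s - \<omega>\<close>) > 0, and the rest has a sign because cos \<omega> exp
    (- \<xi>) \<ge> cos \<omega> \<ge> cos \<open>\<phi>\<^sub>s\<close>.\<close>
  also have "cosh \<xi> = sinh \<xi> + exp (- \<xi>)" by (simp add: cosh_def sinh_def field_simps)
  also have "K * (cos \<phi>\<^sub>s * sin \<omega> * sinh \<xi> + cos \<phi>\<^sub>s * sin \<phi>\<^sub>s - cos \<omega> * sin \<phi>\<^sub>s * (sinh \<xi> + exp (- \<xi>)))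
      = - (K * (sinh \<xi> * (sin \<phi>\<^sub>s * cos \<omega> - cos \<phi>\<^sub>s * sin \<omega>) + sin \<phi>\<^sub>s * (cos \<omega> * exp (- \<xi>) - cos \<phi>\<^sub>s)))"
    by (simp add: algebra_simps)
  also have "\<dots> < 0" using 1 2 hyperbola_scale_pos by (simp add: add_pos_nonneg)
  finally have "Im ?z * cos \<phi>\<^sub>s < Re ?z * sin \<phi>\<^sub>s" by simp
  moreover have z: "Im ?z = cmod ?z * sin (Arg ?z)" "Re ?z = cmod ?z * cos (Arg ?z)"
    by (metis rcis_cmod_Arg Im_rcis, metis rcis_cmod_Arg Re_rcis)
  moreover have z0: "0 < cmod ?z" using Im by auto
  ultimately have "cmod ?z * (sin (Arg ?z) * cos \<phi>\<^sub>s) < cmod ?z * (cos (Arg ?z) * sin \<phi>\<^sub>s)"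
    by (simp only: mult.assoc)
  then have neg: "sin (Arg ?z - \<phi>\<^sub>s) < 0"
    using z0 by (simp only: mult_less_cancel_left_pos sin_diff)
  have "0 < Arg ?z" "Arg ?z < pi" using Arg_lt_pi[of ?z] Im by auto
  show "Arg ?z < \<phi>\<^sub>s"
  proof (rule ccontr)
    assume "\<not> Arg ?z < \<phi>\<^sub>s"
    then have "0 \<le> sin (Arg ?z - \<phi>\<^sub>s)"
      using \<open>Arg ?z < pi\<close> \<phi>\<^sub>s by (intro sin_ge_zero) auto
    with neg show False by simp
  qed
qed

text \<open>Conjugation reduces the claim to \<xi> \<ge> 0. The vertex \<xi> = 0 is treated apart:
  it is the real point K (cos \<omega> - cos \<open>\<phi>\<^sub>s\<close>) > 0.\<close>

lemma hyperbola_sector: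
  "hyperbola a\<^sub>0 a b \<xi> \<notin> \<real>\<^sub>\<le>\<^sub>0" (is ?A) "\<bar>Im (Ln (hyperbola a\<^sub>0 a b \<xi>))\<bar> < \<phi>\<^sub>s" (is ?B)
proof -
  have up: "hyperbola a\<^sub>0 a b \<xi> \<notin> \<real>\<^sub>\<le>\<^sub>0 \<and> \<bar>Im (Ln (hyperbola a\<^sub>0 a b \<xi>))\<bar> < \<phi>\<^sub>s" if "0 \<le> \<xi>" for \<xi>
  proof (cases "\<xi> = 0")
    case True
    have "cos \<phi>\<^sub>s < cos \<omega>" using hyperbola_angle_bounds \<phi>\<^sub>s by (intro cos_monotone_0_pi) auto
    then have "0 < K * (cos \<omega> - cos \<phi>\<^sub>s)" using hyperbola_scale_pos by simp
    then have "0 < a\<^sub>0 - a" by (simp add: hyperbola_params algebra_simps)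
    moreover have "hyperbola a\<^sub>0 a b \<xi> = of_real (a\<^sub>0 - a)" by (simp add: True hyperbola_def)
    ultimately show ?thesis using \<phi>\<^sub>s pi_gt_zero
      by (auto simp: complex_nonpos_Reals_iff Ln_of_real simp del: of_real_diff)
  next
    case False
    then have "0 < \<xi>" using that by simp
    note U = hyperbola_upper[OF this]
    have "hyperbola a\<^sub>0 a b \<xi> \<noteq> 0" using U(1) by auto
    then have "Im (Ln (hyperbola a\<^sub>0 a b \<xi>)) < \<phi>\<^sub>s" using U(2) by (simp add: Arg_eq_Im_Ln)
    then show ?thesis using U(1) Im_Ln_pos_lt_imp[OF U(1)] by (auto simp: complex_nonpos_Reals_iff)
  qed
  have "?A \<and> ?B"
  proof (cases "0 \<le> \<xi>")
    case False
    then have "hyperbola a\<^sub>0 a b \<xi> = cnj (hyperbola a\<^sub>0 a b (- \<xi>))" "0 \<le> - \<xi>"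
      using hyperbola_uminus[of a\<^sub>0 a b "- \<xi>"] by auto
    then show ?thesis
      using up[of "- \<xi>"] cnj_Ln[of "hyperbola a\<^sub>0 a b (- \<xi>)"]
      by (simp add: complex_nonpos_Reals_iff flip: cnj_Ln)
  qed (use up in blast)
  then show ?A ?B by auto
qed

lemma Ln_hyperbola_uminus: "Ln (hyperbola a\<^sub>0 a b (- \<xi>)) = cnj (Ln (hyperbola a\<^sub>0 a b \<xi>))"
  using cnj_Ln[OF hyperbola_sector(1)] by (simp add: hyperbola_uminus)

lemma Ln_hyperbola_has_vector_derivative:
  "((\<lambda>\<xi>. Ln (hyperbola a\<^sub>0 a b \<xi>)) has_vector_derivative hyperbola' a b \<xi> / hyperbola a\<^sub>0 a b \<xi>) (at \<xi>)"
proof -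
  have "has_cderiv Ln (inverse (hyperbola a\<^sub>0 a b \<xi>)) (hyperbola a\<^sub>0 a b \<xi>)"
    using has_field_derivative_Ln[OF hyperbola_sector(1)] by (simp add: has_cderiv_complex)
  from has_vector_derivative_compose_cderiv[OF this hyperbola_has_vector_derivative] show ?thesis
    by (simp add: scaleC_complex_def divide_inverse)
qed

lemma Re_Ln_hyperbola_at_top: "filterlim (\<lambda>\<xi>. Re (Ln (hyperbola a\<^sub>0 a b \<xi>))) at_top at_top"
proof -
  have nz: "hyperbola a\<^sub>0 a b \<xi> \<noteq> 0" for \<xi> using hyperbola_sector(1)[of \<xi>] by auto
  have "0 < b" using hyperbola_scale_pos hyperbola_angle_bounds by (simp add: hyperbola_params)
  then have "filterlim (\<lambda>\<xi>. b * sinh \<xi>) at_top at_top" by real_asymp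
  then have "filterlim (\<lambda>\<xi>. cmod (hyperbola a\<^sub>0 a b \<xi>)) at_top at_top"
  proof (rule filterlim_at_top_mono, intro always_eventually allI)
    fix \<xi> show "b * sinh \<xi> \<le> cmod (hyperbola a\<^sub>0 a b \<xi>)"
      using abs_Im_le_cmod[of "hyperbola a\<^sub>0 a b \<xi>"] by (simp add: hyperbola_def)
  qed
  then show ?thesis
    using filterlim_compose[OF ln_at_top] nz by simp
qed

text \<open>The positive factor 2 exp (- \<xi>) leaves the argument unchanged and makes the curve
  converge to - a + i b = K exp (i \<omega>), a point off the branch cut.\<close>

lemma Im_Ln_hyperbola_at_top: "((\<lambda>\<xi>. Im (Ln (hyperbola a\<^sub>0 a b \<xi>))) \<longlongrightarrow> \<omega>) at_top"
proof -
  have nz: "hyperbola a\<^sub>0 a b \<xi> \<noteq> 0" for \<xi> using hyperbola_sector(1)[of \<xi>] by auto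
  define l where "l = Complex (- a) b"
  have l: "l = of_real K * cis \<omega>" by (simp add: l_def complex_eq_iff hyperbola_params)
  have "((\<lambda>\<xi>. 2 * exp (- \<xi>) * (a\<^sub>0 - a * cosh \<xi>)) \<longlongrightarrow> - a) at_top"
    by (simp add: cosh_def) real_asymp
  moreover have "((\<lambda>\<xi>. 2 * exp (- \<xi>) * (b * sinh \<xi>)) \<longlongrightarrow> b) at_top"
    by (simp add: sinh_def) real_asymp
  ultimately have "((\<lambda>\<xi>. Complex (2 * exp (- \<xi>) * (a\<^sub>0 - a * cosh \<xi>)) (2 * exp (- \<xi>) * (b * sinh \<xi>)))
      \<longlongrightarrow> l) at_top"
    unfolding l_def by (rule tendsto_Complex)
  also have "(\<lambda>\<xi>. Complex (2 * exp (- \<xi>) * (a\<^sub>0 - a * cosh \<xi>)) (2 * exp (- \<xi>) * (b * sinh \<xi>)))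
      = (\<lambda>\<xi>. of_real (2 * exp (- \<xi>)) * hyperbola a\<^sub>0 a b \<xi>)"
    by (auto simp: hyperbola_def complex_eq_iff Re_exp Im_exp)
  finally have lim: "((\<lambda>\<xi>. of_real (2 * exp (- \<xi>)) * hyperbola a\<^sub>0 a b \<xi>) \<longlongrightarrow> l) at_top" .
  have "l \<notin> \<real>\<^sub>\<le>\<^sub>0"
    using hyperbola_scale_pos hyperbola_angle_bounds by (auto simp: l_def hyperbola_params complex_nonpos_Reals_iff)
  have "((\<lambda>\<xi>. Im (Ln (of_real (2 * exp (- \<xi>)) * hyperbola a\<^sub>0 a b \<xi>))) \<longlongrightarrow> Im (Ln l)) at_top"
    by (intro tendsto_Im tendsto_Ln lim \<open>l \<notin> _\<close>)
  moreover have "Im (Ln (of_real (2 * exp (- \<xi>)) * hyperbola a\<^sub>0 a b \<xi>)) = Im (Ln (hyperbola a\<^sub>0 a b \<xi>))" for \<xi>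
    by (subst Ln_times_of_real) (auto simp: nz simp del: of_real_mult)
  moreover have "Im (Ln l) = \<omega>"
  proof -
    have "Arg l = \<omega>" using hyperbola_scale_pos hyperbola_angle_bounds
      by (intro Arg_unique[of K]) (auto simp: l cis_conv_exp)
    then show ?thesis using \<open>l \<notin> _\<close> Arg_eq_Im_Ln[of l] by force
  qed
  ultimately show ?thesis by simp
qed

end

section \<open>Integral representations\<close>

lemma strip_open_convex: "open {z. \<bar>Im z\<bar> < c}" "convex {z. \<bar>Im z\<bar> < c}"
proof -
  have V: "{z. \<bar>Im z\<bar> < c} = {z. Im z < c} \<inter> {z. - c < Im z}" by auto
  show "open {z. \<bar>Im z\<bar> < c}"
    unfolding V by (intro open_Int open_halfspace_Im_lt open_halfspace_Im_gt)
  show "convex {z. \<bar>Im z\<bar> < c}"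
    unfolding V by (intro convex_Int convex_halfspace_Im_lt convex_halfspace_Im_gt)
qed

text \<open>The limits P and N are exported for straight lines as well as for the curve, since
  through them the rays are matched with the hyperbola. Decay is asked for only where the paths
  escape, whereas the primitive lives on the full strip and links the two ends.\<close>

lemma contour_limits:
  fixes h :: "real \<Rightarrow> complex \<Rightarrow> 'a::cbanach" and \<zeta> \<zeta>' :: "real \<Rightarrow> complex"
  assumes c1: "\<And>t. t \<in> S \<Longrightarrow> c1_on {z. \<bar>Im z\<bar> < \<phi>\<^sub>s} (h t)"
    and "0 < \<delta>" and \<theta>: "\<theta>\<^sub>1 < \<theta>\<^sub>2" "0 \<le> \<theta>\<^sub>1" "\<theta>\<^sub>2 < \<phi>\<^sub>s"
    and bound: "\<And>t z. t \<in> S \<Longrightarrow> 0 \<le> Re z \<Longrightarrow> \<bar>Im z\<bar> \<in> {\<theta>\<^sub>1..\<theta>\<^sub>2} \<Longrightarrow> norm (h t z) \<le> C * exp (- \<delta> * Re z)"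
    and der: "\<And>s. (\<zeta> has_vector_derivative \<zeta>' s) (at s)"
    and in_V: "\<And>s. \<bar>Im (\<zeta> s)\<bar> < \<phi>\<^sub>s"
    and Re_top: "filterlim (\<lambda>s. Re (\<zeta> s)) at_top at_top"
    and Im_top: "((\<lambda>s. Im (\<zeta> s)) \<longlongrightarrow> \<omega>) at_top" "\<omega> \<in> {\<theta>\<^sub>1<..<\<theta>\<^sub>2}"
    and sym: "\<And>s. \<zeta> (- s) = cnj (\<zeta> s)"
  obtains G P N where
    "\<And>t z. t \<in> S \<Longrightarrow> \<bar>Im z\<bar> < \<phi>\<^sub>s \<Longrightarrow> has_cderiv (G t) (h t z) z"
    and "\<And>t y. t \<in> S \<Longrightarrow> y \<in> {\<theta>\<^sub>1..\<theta>\<^sub>2} \<Longrightarrow> ((\<lambda>x. G t (Complex x y)) \<longlongrightarrow> P t) at_top"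
    and "\<And>t y. t \<in> S \<Longrightarrow> y \<in> {\<theta>\<^sub>1..\<theta>\<^sub>2} \<Longrightarrow> ((\<lambda>x. G t (Complex x (- y))) \<longlongrightarrow> N t) at_top"
    and "uniformly_convergent_integral S (\<lambda>t s. \<zeta>' s *\<^sub>C h t (\<zeta> s))"
    and "\<And>t. t \<in> S \<Longrightarrow> integral UNIV (\<lambda>s. \<zeta>' s *\<^sub>C h t (\<zeta> s)) = P t - N t"
proof -
  let ?V = "{z. \<bar>Im z\<bar> < \<phi>\<^sub>s}"
  have "\<exists>G. t \<in> S \<longrightarrow> (\<forall>z. \<bar>Im z\<bar> < \<phi>\<^sub>s \<longrightarrow> has_cderiv G (h t z) z)" for t
  proof (cases "t \<in> S")
    case True
    show ?thesis
      by (rule c1_on_primitive[OF strip_open_convex(2,1) c1[OF True]]) auto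
  qed simp
  then obtain G where G: "\<And>t z. t \<in> S \<Longrightarrow> \<bar>Im z\<bar> < \<phi>\<^sub>s \<Longrightarrow> has_cderiv (G t) (h t z) z"
    by metis
  define B where "B = (\<lambda>x. C * (\<theta>\<^sub>2 - \<theta>\<^sub>1 + 1 / \<delta>) * exp (- \<delta> * x))"
  have B0: "(B \<longlongrightarrow> 0) at_top" unfolding B_def using \<open>0 < \<delta>\<close> by real_asymp
  have "\<exists>L. t \<in> S \<longrightarrow> (\<forall>z. 0 \<le> Re z \<longrightarrow> Im z \<in> {\<theta>\<^sub>1..\<theta>\<^sub>2} \<longrightarrow> norm (G t z - L) \<le> B (Re z))" for t
  proof (cases "t \<in> S")
    case True
    show ?thesis
      by (rule primitive_limit_at_end[of \<delta> \<theta>\<^sub>1 \<theta>\<^sub>2 "G t" "h t" C])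
        (use \<open>0 < \<delta>\<close> \<theta> G[OF True] bound[OF True] in \<open>auto simp: B_def\<close>)
  qed simp
  then obtain P where P: "\<And>t z. t \<in> S \<Longrightarrow> 0 \<le> Re z \<Longrightarrow> Im z \<in> {\<theta>\<^sub>1..\<theta>\<^sub>2} \<Longrightarrow> norm (G t z - P t) \<le> B (Re z)"
    by metis
  \<comment> \<open>The lower end gets its own limit: the bound does not control \<open>G\<close>
    across |Im z| < \<open>\<theta>\<^sub>1\<close>.\<close>
  have "\<exists>L. t \<in> S \<longrightarrow> (\<forall>z. 0 \<le> Re z \<longrightarrow> Im z \<in> {- \<theta>\<^sub>2..- \<theta>\<^sub>1} \<longrightarrow> norm (G t z - L) \<le> B (Re z))" for t
  proof (cases "t \<in> S")
    case True
    show ?thesis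
      by (rule primitive_limit_at_end[of \<delta> "- \<theta>\<^sub>2" "- \<theta>\<^sub>1" "G t" "h t" C])
        (use \<open>0 < \<delta>\<close> \<theta> G[OF True] bound[OF True] in \<open>auto simp: B_def\<close>)
  qed simp
  then obtain N where N: "\<And>t z. t \<in> S \<Longrightarrow> 0 \<le> Re z \<Longrightarrow> Im z \<in> {- \<theta>\<^sub>2..- \<theta>\<^sub>1} \<Longrightarrow> norm (G t z - N t) \<le> B (Re z)"
    by metis
  have Im_ev: "\<forall>\<^sub>F s in at_top. Im (\<zeta> s) \<in> {\<theta>\<^sub>1..\<theta>\<^sub>2} \<and> 0 \<le> Re (\<zeta> s)"
  proof -
    have "\<forall>\<^sub>F s in at_top. \<theta>\<^sub>1 < Im (\<zeta> s)" "\<forall>\<^sub>F s in at_top. Im (\<zeta> s) < \<theta>\<^sub>2"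
      using Im_top by (auto intro: order_tendstoD)
    moreover have "\<forall>\<^sub>F s in at_top. 0 \<le> Re (\<zeta> s)"
      using Re_top by (simp add: filterlim_at_top)
    ultimately show ?thesis by eventually_elim auto
  qed
  have eB: "((\<lambda>s. B (Re (\<zeta> s))) \<longlongrightarrow> 0) at_top"
    by (rule filterlim_compose[OF B0 Re_top])
  have bot: "filterlim (uminus :: real \<Rightarrow> real) at_top at_bot"
    by (rule filterlim_uminus_at_top_at_bot)
  have top: "\<forall>\<^sub>F s in at_top. \<forall>t\<in>S. norm (G t (\<zeta> s) - P t) \<le> B (Re (\<zeta> s))"
    using Im_ev by eventually_elim (auto intro: P)
  have bot': "\<forall>\<^sub>F s in at_bot. \<forall>t\<in>S. norm (G t (\<zeta> s) - N t) \<le> B (Re (\<zeta> s))"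
  proof -
    have "\<forall>\<^sub>F s in at_bot. Im (\<zeta> (- s)) \<in> {\<theta>\<^sub>1..\<theta>\<^sub>2} \<and> 0 \<le> Re (\<zeta> (- s))"
      using eventually_compose_filterlim[OF Im_ev bot] by simp
    then show ?thesis by eventually_elim (auto simp: sym intro!: N)
  qed
  have eB': "((\<lambda>s. B (Re (\<zeta> s))) \<longlongrightarrow> 0) at_bot"
    using filterlim_compose[OF eB bot] by (simp add: sym)
  have der': "((\<lambda>s. G t (\<zeta> s)) has_vector_derivative \<zeta>' s *\<^sub>C h t (\<zeta> s)) (at s)" if "t \<in> S" for t s
    by (rule has_vector_derivative_compose_cderiv[OF G[OF that in_V] der])
  note U = uniformly_convergent_integral_primitive[OF der' top eB bot' eB']
  have "((\<lambda>x. G t (Complex x y)) \<longlongrightarrow> P t) at_top" "((\<lambda>x. G t (Complex x (- y))) \<longlongrightarrow> N t) at_top"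
    if "t \<in> S" "y \<in> {\<theta>\<^sub>1..\<theta>\<^sub>2}" for t y
    using P[OF that(1), of "Complex _ y"] N[OF that(1), of "Complex _ (- y)"] that(2)
    unfolding B_def by (auto intro!: tendsto_by_exp_bound[OF \<open>0 < \<delta>\<close>,
        where K = "C * (\<theta>\<^sub>2 - \<theta>\<^sub>1 + 1 / \<delta>)"])
  then show thesis using that[of G P N] G U by blast
qed

text \<open>The source of uniformity in t: here exp z lies in the closed left half-plane.\<close>

lemma norm_exp_le_1:
  assumes "0 \<le> t" "pi / 2 \<le> \<bar>Im z\<bar>" "\<bar>Im z\<bar> \<le> pi"
  shows "cmod (exp (of_real t * exp z)) \<le> 1"
proof -
  have "cos \<bar>Im z\<bar> \<le> cos (pi / 2)" using assms by (intro cos_monotone_0_pi_le) auto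
  then have "cos (Im z) \<le> 0" by (simp add: cos_abs_real)
  then show ?thesis
    using assms(1) by (simp add: norm_exp_eq_Re Re_exp mult_nonneg_nonpos)
qed

lemma uniformly_convergent_integral_subset:
  "uniformly_convergent_integral S f \<Longrightarrow> T \<subseteq> S \<Longrightarrow> uniformly_convergent_integral T f"
  unfolding uniformly_convergent_integral_def by (blast intro: uniform_limit_on_subset)

text \<open>On this strip Ln inverts exp, so principal powers become entire functions of the
  coordinate.\<close>

lemma powr_exp_strip:
  fixes c z :: complex
  assumes "\<bar>Im z\<bar> < pi" shows "exp z powr c = exp (c * z)"
  using assms by (simp add: powr_def)

theorem lemma1:
  fixes D :: "'a::cbanach set" and A :: "'a \<Rightarrow> 'a"
    and \<alpha> \<rho>\<^sub>s \<phi> a\<^sub>0 \<phi>\<^sub>s a\<^sub>I b\<^sub>I r \<theta> \<gamma> :: real and u\<^sub>0 u\<^sub>1 :: 'a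
  assumes "0 < \<alpha>" and "\<alpha> < 2"
    and "sectorial D A \<rho>\<^sub>s \<phi>"
    and "\<phi> < pi * min (1 / 2) (1 - \<alpha> / 2)"
    and "0 < a\<^sub>0"
    and "\<phi>\<^sub>s = min pi ((pi - \<phi>) / \<alpha>)"
    and "a\<^sub>I = a\<^sub>0 / cos \<phi>\<^sub>s * cos (\<phi>\<^sub>s / 2 + pi / 4)"
    and "b\<^sub>I = - (a\<^sub>0 / cos \<phi>\<^sub>s * sin (\<phi>\<^sub>s / 2 + pi / 4))"
    and "0 < r" and "pi / 2 < \<theta>" and "\<theta> < \<phi>\<^sub>s"
    and "0 < \<gamma>" and "u\<^sub>0 \<in> frac_power_domain D A \<rho>\<^sub>s \<gamma>"
  shows "(\<forall>t\<ge>0. S_a D A r \<theta> \<alpha> t u\<^sub>0 =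
            (1 / (2 * of_real pi * \<i>)) *\<^sub>C
              integral UNIV (\<lambda>\<xi>. exp (hyperbola a\<^sub>0 a\<^sub>I b\<^sub>I \<xi> * of_real t) *\<^sub>C F1 D A \<alpha> a\<^sub>0 a\<^sub>I b\<^sub>I \<xi> u\<^sub>0)
            + u\<^sub>0)
       \<and> (\<forall>t\<ge>0. S_ab D A r \<theta> \<alpha> 2 t u\<^sub>1 =
            (1 / (2 * of_real pi * \<i>)) *\<^sub>C
              integral UNIV (\<lambda>\<xi>. exp (hyperbola a\<^sub>0 a\<^sub>I b\<^sub>I \<xi> * of_real t) *\<^sub>C F2 D A \<alpha> a\<^sub>0 a\<^sub>I b\<^sub>I \<xi> u\<^sub>1))
       \<and> (\<forall>T. uniformly_convergent_integral {0..T}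
            (\<lambda>t \<xi>. exp (hyperbola a\<^sub>0 a\<^sub>I b\<^sub>I \<xi> * of_real t) *\<^sub>C F1 D A \<alpha> a\<^sub>0 a\<^sub>I b\<^sub>I \<xi> u\<^sub>0))
       \<and> (\<forall>T. uniformly_convergent_integral {0..T}
            (\<lambda>t \<xi>. exp (hyperbola a\<^sub>0 a\<^sub>I b\<^sub>I \<xi> * of_real t) *\<^sub>C F2 D A \<alpha> a\<^sub>0 a\<^sub>I b\<^sub>I \<xi> u\<^sub>1))"
proof -

  \<comment> \<open>Angles and the logarithm of the hyperbola\<close>
  let ?S = "shift_inv D A" and ?V = "{z. \<bar>Im z\<bar> < \<phi>\<^sub>s}"
  let ?z = "hyperbola a\<^sub>0 a\<^sub>I b\<^sub>I" and ?z' = "hyperbola' a\<^sub>I b\<^sub>I"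
  let ?c = "1 / (2 * of_real pi * \<i>) :: complex"
  have sec: "0 < \<rho>\<^sub>s" "\<phi> < pi / 2" "closed_operator D A"
    using assms(3) by (auto simp: sectorial_def)
  note assms(4)
  also have "pi * min (1 / 2) (1 - \<alpha> / 2) \<le> pi * (1 - \<alpha> / 2)" by (intro mult_left_mono) auto
  finally have "pi / 2 < (pi - \<phi>) / \<alpha>" using \<open>0 < \<alpha>\<close> by (simp add: field_simps)
  then have \<phi>\<^sub>s: "pi / 2 < \<phi>\<^sub>s" "\<phi>\<^sub>s \<le> pi" "\<alpha> * \<phi>\<^sub>s \<le> pi - \<phi>"
    using assms(6) pi_gt_zero \<open>0 < \<alpha>\<close> by (auto simp: min_def field_simps)
  define \<omega> where "\<omega> = \<phi>\<^sub>s / 2 + pi / 4"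
  define K where "K = - (a\<^sub>0 / cos \<phi>\<^sub>s)"
  note aI = assms(7)[folded \<omega>_def] and bI = assms(8)[folded \<omega>_def]
  note hyp = \<open>0 < a\<^sub>0\<close> \<phi>\<^sub>s(1,2) \<omega>_def aI bI K_def
  have \<omega>: "pi / 2 < \<omega>" "\<omega> < \<phi>\<^sub>s" using hyperbola_angle_bounds[OF hyp] by auto
  define \<zeta> where "\<zeta> = (\<lambda>\<xi>. Ln (?z \<xi>))"
  have z_nz: "?z \<xi> \<noteq> 0" for \<xi> using hyperbola_sector(1)[OF hyp, of \<xi>] by auto
  have \<zeta>_der: "(\<zeta> has_vector_derivative ?z' \<xi> / ?z \<xi>) (at \<xi>)" for \<xi>
    unfolding \<zeta>_def by (rule Ln_hyperbola_has_vector_derivative[OF hyp])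
  have \<zeta>_V: "\<bar>Im (\<zeta> \<xi>)\<bar> < \<phi>\<^sub>s" for \<xi> unfolding \<zeta>_def by (rule hyperbola_sector(2)[OF hyp])
  have exp_\<zeta>: "exp (\<zeta> \<xi>) = ?z \<xi>" for \<xi> unfolding \<zeta>_def using z_nz by simp
  have z_powr: "?z \<xi> powr c = exp (c * \<zeta> \<xi>)" for \<xi> c using z_nz by (simp add: powr_def \<zeta>_def)
  \<comment> \<open>Midpoints keep the band between \<pi>/2 and \<open>\<phi>\<^sub>s\<close>;
    \<omega> must be interior to it because Im (\<zeta> \<xi>) only tends to \<omega>.\<close>
  define \<theta>\<^sub>1 where "\<theta>\<^sub>1 = (pi / 2 + min \<omega> \<theta>) / 2"
  define \<theta>\<^sub>2 where "\<theta>\<^sub>2 = (\<phi>\<^sub>s + max \<omega> \<theta>) / 2"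
  have \<theta>s: "pi / 2 < \<theta>\<^sub>1" "\<theta>\<^sub>1 < \<theta>\<^sub>2" "\<theta>\<^sub>2 < \<phi>\<^sub>s" "\<omega> \<in> {\<theta>\<^sub>1<..<\<theta>\<^sub>2}" "\<theta> \<in> {\<theta>\<^sub>1..\<theta>\<^sub>2}"
    using \<omega> assms(10,11) by (auto simp: \<theta>\<^sub>1_def \<theta>\<^sub>2_def min_def max_def)
  then have "0 \<le> \<theta>\<^sub>1" "0 \<le> \<theta>" using pi_gt_zero unfolding atLeastAtMost_iff by linarith+

  \<comment> \<open>The resolvent on the strip\<close>
  obtain M where M: "0 \<le> M"
    and resM: "\<And>w. - w \<notin> Sigma_sector \<rho>\<^sub>s \<phi> \<Longrightarrow> - w \<in> resolvent_set D A"
    and bdM: "\<And>w x. - w \<notin> Sigma_sector \<rho>\<^sub>s \<phi> \<Longrightarrow> norm (?S w x) \<le> M / (1 + cmod w) * norm x"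
    using sectorial_resolvent_bound[OF assms(3)] by blast
  have good: "- exp (of_real \<alpha> * z) \<notin> Sigma_sector \<rho>\<^sub>s \<phi>" if "\<bar>Im z\<bar> < \<phi>\<^sub>s" for z
  proof (rule neg_exp_notin_Sigma_sector[OF sec(1,2)])
    have "\<bar>Im (of_real \<alpha> * z)\<bar> = \<alpha> * \<bar>Im z\<bar>" using \<open>0 < \<alpha>\<close> by (simp add: abs_mult)
    also have "\<dots> < \<alpha> * \<phi>\<^sub>s" using that \<open>0 < \<alpha>\<close> by simp
    finally show "\<bar>Im (of_real \<alpha> * z)\<bar> < pi - \<phi>" using \<phi>\<^sub>s(3) by simp
  qed
  have bd1: "norm (?S (exp (of_real \<alpha> * z)) x) \<le> M * norm x" if "\<bar>Im z\<bar> < \<phi>\<^sub>s" for z x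
  proof -
    have "M / (1 + cmod (exp (of_real \<alpha> * z))) \<le> M"
      using M by (simp add: divide_le_eq add_pos_nonneg mult_left_le distrib_left)
    then show ?thesis using bdM[OF good[OF that], of x] by (meson mult_right_mono norm_ge_zero order_trans)
  qed
  have c1_S: "c1_on ?V (\<lambda>z. ?S (exp (of_real \<alpha> * z)) x)" for x
    using \<open>0 < \<alpha>\<close> good bd1 resM by (intro c1_on_shift_inv_exp[OF sec(3) strip_open_convex(1), where M = M]) auto
  have strip: "\<bar>Im z\<bar> < pi" if "\<bar>Im z\<bar> < \<phi>\<^sub>s" for z using that \<phi>\<^sub>s(2) by simp
  note exp_le_1 = norm_exp_le_1[OF _ less_imp_le[OF less_le_trans[OF \<theta>s(1)]]]

  \<comment> \<open>The integrand for \<beta> = 2\<close>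
  define h2 where "h2 = (\<lambda>t z. (exp (of_real t * exp z) * exp ((of_real \<alpha> - 1) * z)) *\<^sub>C
      ?S (exp (of_real \<alpha> * z)) u\<^sub>1)"
  have c1_h2: "c1_on ?V (h2 t)" for t
    unfolding h2_def
    by (intro c1_on_scaleC c1_on_mult c1_on_exp c1_on_cmult c1_on_ident c1_S)
  have bound2: "norm (h2 t z) \<le> (M * norm u\<^sub>1) * exp (- 1 * Re z)"
    if "t \<in> {0..}" "\<bar>Im z\<bar> \<in> {\<theta>\<^sub>1..\<theta>\<^sub>2}" for t z
  proof -
    have V: "\<bar>Im z\<bar> < \<phi>\<^sub>s" using that \<theta>s by auto
    let ?e = "exp (\<alpha> * Re z)"
    have "norm (h2 t z) = cmod (exp (of_real t * exp z)) * (exp ((\<alpha> - 1) * Re z) * norm (?S (exp (of_real \<alpha> * z)) u\<^sub>1))"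
      by (simp add: h2_def norm_scaleC norm_mult norm_exp_eq_Re[of "(of_real \<alpha> - 1) * z"])
    also have "\<dots> \<le> 1 * (exp ((\<alpha> - 1) * Re z) * (M / (1 + ?e) * norm u\<^sub>1))"
      using that V strip[OF V] bdM[OF good[OF V], of u\<^sub>1]
      by (intro mult_mono exp_le_1) (auto simp: norm_exp_eq_Re)
    also have "exp ((\<alpha> - 1) * Re z) = ?e * exp (- Re z)" by (simp add: exp_add[symmetric] algebra_simps)
    also have "1 * (?e * exp (- Re z) * (M / (1 + ?e) * norm u\<^sub>1))
        = (M * norm u\<^sub>1) * exp (- Re z) * (?e / (1 + ?e))" by simp
    also have "\<dots> \<le> (M * norm u\<^sub>1) * exp (- Re z) * 1"
      using M by (intro mult_left_mono) (auto simp: divide_simps add_pos_pos)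
    finally show ?thesis by simp
  qed
  obtain G2 P2 N2 where G2:
    "\<And>t z. t \<in> {0..} \<Longrightarrow> \<bar>Im z\<bar> < \<phi>\<^sub>s \<Longrightarrow> has_cderiv (G2 t) (h2 t z) z"
    "\<And>t y. t \<in> {0..} \<Longrightarrow> y \<in> {\<theta>\<^sub>1..\<theta>\<^sub>2} \<Longrightarrow> ((\<lambda>x. G2 t (Complex x y)) \<longlongrightarrow> P2 t) at_top"
    "\<And>t y. t \<in> {0..} \<Longrightarrow> y \<in> {\<theta>\<^sub>1..\<theta>\<^sub>2} \<Longrightarrow> ((\<lambda>x. G2 t (Complex x (- y))) \<longlongrightarrow> N2 t) at_top"
    "uniformly_convergent_integral {0..} (\<lambda>t s. (?z' s / ?z s) *\<^sub>C h2 t (\<zeta> s))"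
    "\<And>t. t \<in> {0..} \<Longrightarrow> integral UNIV (\<lambda>s. (?z' s / ?z s) *\<^sub>C h2 t (\<zeta> s)) = P2 t - N2 t"
    by (rule contour_limits[of "{0..}" \<phi>\<^sub>s h2 1 \<theta>\<^sub>1 \<theta>\<^sub>2 "M * norm u\<^sub>1" \<zeta> "\<lambda>s. ?z' s / ?z s" \<omega>])
      (use c1_h2 bound2 \<theta>s \<zeta>_der \<zeta>_V \<open>0 \<le> \<theta>\<^sub>1\<close> Re_Ln_hyperbola_at_top[OF hyp] Im_Ln_hyperbola_at_top[OF hyp]
        Ln_hyperbola_uminus[OF hyp] in \<open>auto simp: \<zeta>_def\<close>)
  \<comment> \<open>Along the curve d\<zeta> = (z' / z) d\<xi>; the 1 / z cancels the factor that dz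
    = z d\<zeta> put into \<open>h2\<close>, whose exponent is therefore \<alpha> - 1 instead of
    \<alpha> - 2.\<close>
  have h2_eq: "(?z' \<xi> / ?z \<xi>) *\<^sub>C h2 t (\<zeta> \<xi>) = exp (?z \<xi> * of_real t) *\<^sub>C F2 D A \<alpha> a\<^sub>0 a\<^sub>I b\<^sub>I \<xi> u\<^sub>1" for t \<xi>
  proof -
    have "exp ((of_real \<alpha> - 1) * \<zeta> \<xi>) = ?z \<xi> * exp ((of_real \<alpha> - 2) * \<zeta> \<xi>)"
      by (simp add: exp_\<zeta>[symmetric] exp_add[symmetric] algebra_simps)
    then show ?thesis
      using z_nz[of \<xi>] by (simp add: h2_def F2_def Let_def z_powr exp_\<zeta> scaleC_scaleC mult_ac)
  qed

  \<comment> \<open>The integrand for \<beta> = 1\<close>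
  obtain C \<delta> where \<delta>: "0 < \<delta>" "0 \<le> C" and decay: "\<And>w. w \<noteq> 0 \<Longrightarrow> - w \<notin> Sigma_sector \<rho>\<^sub>s \<phi> \<Longrightarrow>
      norm (w *\<^sub>C ?S w u\<^sub>0 - u\<^sub>0) \<le> C * cmod w powr (- \<delta>)"
    using frac_power_domain_decay[OF assms(3,12,13)] by blast
  \<comment> \<open>This is z times the bracket of \<open>F1\<close>: the subtracted 1 / z becomes
    the constant \<open>u\<^sub>0\<close>, and the decay estimate applies with w =
    z^\<alpha>.\<close>
  define k where "k = (\<lambda>z. exp (of_real \<alpha> * z) *\<^sub>C ?S (exp (of_real \<alpha> * z)) u\<^sub>0 + (- u\<^sub>0))"
  define h1 where "h1 = (\<lambda>t z. exp (of_real t * exp z) *\<^sub>C k z)"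
  have c1_h1: "c1_on ?V (h1 t)" for t
    unfolding h1_def k_def
    by (intro c1_on_scaleC c1_on_add c1_on_const c1_on_exp c1_on_cmult c1_on_ident c1_S)
  \<comment> \<open>Without the factor exp (z t) the bound reaches down to Im z = 0; the case t = 0
    relies on this.\<close>
  have bound_k: "norm (k z) \<le> C * exp (- (\<alpha> * \<delta>) * Re z)" if "\<bar>Im z\<bar> < \<phi>\<^sub>s" for z
    using decay[OF _ good[OF that]] by (simp add: k_def norm_exp_eq_Re powr_def mult_ac)
  have bound1: "norm (h1 t z) \<le> C * exp (- (\<alpha> * \<delta>) * Re z)"
    if "t \<in> {0..}" "\<bar>Im z\<bar> \<in> {\<theta>\<^sub>1..\<theta>\<^sub>2}" for t z
  proof -
    have V: "\<bar>Im z\<bar> < \<phi>\<^sub>s" using that \<theta>s by auto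
    have "norm (h1 t z) \<le> 1 * (C * exp (- (\<alpha> * \<delta>) * Re z))"
      unfolding h1_def norm_scaleC
      using that strip[OF V] bound_k[OF V] by (intro mult_mono exp_le_1) auto
    then show ?thesis by simp
  qed
  have "0 < \<alpha> * \<delta>" using \<delta> \<open>0 < \<alpha>\<close> by simp
  obtain G1 P1 N1 where G1:
    "\<And>t z. t \<in> {0..} \<Longrightarrow> \<bar>Im z\<bar> < \<phi>\<^sub>s \<Longrightarrow> has_cderiv (G1 t) (h1 t z) z"
    "\<And>t y. t \<in> {0..} \<Longrightarrow> y \<in> {\<theta>\<^sub>1..\<theta>\<^sub>2} \<Longrightarrow> ((\<lambda>x. G1 t (Complex x y)) \<longlongrightarrow> P1 t) at_top"
    "\<And>t y. t \<in> {0..} \<Longrightarrow> y \<in> {\<theta>\<^sub>1..\<theta>\<^sub>2} \<Longrightarrow> ((\<lambda>x. G1 t (Complex x (- y))) \<longlongrightarrow> N1 t) at_top"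
    "uniformly_convergent_integral {0..} (\<lambda>t s. (?z' s / ?z s) *\<^sub>C h1 t (\<zeta> s))"
    "\<And>t. t \<in> {0..} \<Longrightarrow> integral UNIV (\<lambda>s. (?z' s / ?z s) *\<^sub>C h1 t (\<zeta> s)) = P1 t - N1 t"
    by (rule contour_limits[of "{0..}" \<phi>\<^sub>s h1 "\<alpha> * \<delta>" \<theta>\<^sub>1 \<theta>\<^sub>2 C \<zeta> "\<lambda>s. ?z' s / ?z s" \<omega>])
      (use c1_h1 bound1 \<open>0 < \<alpha> * \<delta>\<close> \<theta>s \<zeta>_der \<zeta>_V \<open>0 \<le> \<theta>\<^sub>1\<close> Re_Ln_hyperbola_at_top[OF hyp]
        Im_Ln_hyperbola_at_top[OF hyp] Ln_hyperbola_uminus[OF hyp] in \<open>auto simp: \<zeta>_def\<close>)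
  have h1_eq: "(?z' \<xi> / ?z \<xi>) *\<^sub>C h1 t (\<zeta> \<xi>) = exp (?z \<xi> * of_real t) *\<^sub>C F1 D A \<alpha> a\<^sub>0 a\<^sub>I b\<^sub>I \<xi> u\<^sub>0" for t \<xi>
  proof -
    have "exp (of_real \<alpha> * \<zeta> \<xi>) = ?z \<xi> * exp ((of_real \<alpha> - 1) * \<zeta> \<xi>)"
      by (simp add: exp_\<zeta>[symmetric] exp_add[symmetric] algebra_simps)
    then have "(?z' \<xi> / ?z \<xi>) *\<^sub>C h1 t (\<zeta> \<xi>) = exp (?z \<xi> * of_real t) *\<^sub>C ?z' \<xi> *\<^sub>C
        ((1 / ?z \<xi>) *\<^sub>C ((?z \<xi> * exp ((of_real \<alpha> - 1) * \<zeta> \<xi>)) *\<^sub>C ?S (exp (of_real \<alpha> * \<zeta> \<xi>)) u\<^sub>0 - u\<^sub>0))"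
      by (simp add: h1_def k_def exp_\<zeta> scaleC_scaleC mult_ac)
    also have "\<dots> = exp (?z \<xi> * of_real t) *\<^sub>C F1 D A \<alpha> a\<^sub>0 a\<^sub>I b\<^sub>I \<xi> u\<^sub>0"
      using z_nz[of \<xi>] by (simp add: F1_def Let_def z_powr scaleC.diff_right[of "1 / ?z \<xi>"] scaleC_scaleC)
    finally show ?thesis .
  qed

  \<comment> \<open>Comparison with the rays and the arc\<close>
  have S2: "S_ab D A r \<theta> \<alpha> 2 t u\<^sub>1 = ?c *\<^sub>C (P2 t - N2 t)" if t: "t \<in> {0..}" for t
    unfolding S_ab_def
  proof (subst ray_arc_integral_primitive[where G = "G2 t" and P = "P2 t" and N = "N2 t"])
    fix z :: complex assume "\<bar>Im z\<bar> \<le> \<theta>"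
    then have V: "\<bar>Im z\<bar> < \<phi>\<^sub>s" using assms(11) by simp
    have "exp z *\<^sub>C ((exp (exp z * of_real t) * exp z powr of_real (\<alpha> - 2)) *\<^sub>C ?S (exp z powr of_real \<alpha>) u\<^sub>1)
        = h2 t z"
    proof -
      have "exp ((of_real \<alpha> - 1) * z) = exp z * exp ((of_real \<alpha> - 2) * z)"
        by (simp add: exp_add[symmetric] algebra_simps)
      then show ?thesis
        by (simp add: h2_def powr_exp_strip[OF strip[OF V]] scaleC_scaleC mult_ac)
    qed
    then show "has_cderiv (G2 t) (exp z *\<^sub>C ((exp (exp z * of_real t) * exp z powr of_real (\<alpha> - 2)) *\<^sub>C
        ?S (exp z powr of_real \<alpha>) u\<^sub>1)) z"
      using G2(1)[OF t V] by simp
  qed (use assms(9) \<open>0 \<le> \<theta>\<close> G2(2,3)[OF t \<theta>s(5)] in auto)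

  have S1: "S_a D A r \<theta> \<alpha> t u\<^sub>0 = ?c *\<^sub>C (P1 t - N1 t) + u\<^sub>0" if t: "t \<in> {0..}" for t
  proof (cases "t = 0")
    case True
    obtain L where L: "\<And>z. 0 \<le> Re z \<Longrightarrow> Im z \<in> {- \<theta>\<^sub>2..\<theta>\<^sub>2} \<Longrightarrow>
        norm (G1 0 z - L) \<le> C * (\<theta>\<^sub>2 - (- \<theta>\<^sub>2) + 1 / (\<alpha> * \<delta>)) * exp (- (\<alpha> * \<delta>) * Re z)"
    proof (rule primitive_limit_at_end[of "\<alpha> * \<delta>" "- \<theta>\<^sub>2" \<theta>\<^sub>2 "G1 0" k C])
      fix z :: complex assume z: "Im z \<in> {- \<theta>\<^sub>2..\<theta>\<^sub>2}"
      then have V: "\<bar>Im z\<bar> < \<phi>\<^sub>s" using \<theta>s by auto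
      show "has_cderiv (G1 0) (k z) z" using G1(1)[OF _ V, of 0] by (simp add: h1_def)
      show "norm (k z) \<le> C * exp (- (\<alpha> * \<delta>) * Re z)" by (rule bound_k[OF V])
    qed (use \<open>0 < \<alpha> * \<delta>\<close> \<theta>s \<open>0 \<le> \<theta>\<^sub>1\<close> in auto)
    have lim: "((\<lambda>x. G1 0 (Complex x y)) \<longlongrightarrow> L) at_top" if "y \<in> {- \<theta>\<^sub>2..\<theta>\<^sub>2}" for y
      using L[of "Complex _ y"] that by (intro tendsto_by_exp_bound[OF \<open>0 < \<alpha> * \<delta>\<close>,
            where K = "C * (\<theta>\<^sub>2 - (- \<theta>\<^sub>2) + 1 / (\<alpha> * \<delta>))"]) auto
    have "P1 0 = L" "N1 0 = L"
      using tendsto_unique[OF _ G1(2)[of 0 \<theta>] lim[of \<theta>]] tendsto_unique[OF _ G1(3)[of 0 \<theta>] lim[of "- \<theta>"]]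
        \<theta>s \<open>0 \<le> \<theta>\<close> by auto
    then show ?thesis using True by (simp add: S_a_def)
  next
    case False
    then have "0 < t" using t by simp
    obtain E p n where E: "\<And>z. has_cderiv E (exp (of_real t * exp z)) z"
      and Ep: "((\<lambda>x. E (Complex x \<theta>)) \<longlongrightarrow> p) at_top"
      and En: "((\<lambda>x. E (Complex x (- \<theta>))) \<longlongrightarrow> n) at_top"
      and pn: "p - n = 2 * of_real pi * \<i>"
      using exp_exp_primitive[OF \<open>0 < t\<close> assms(10)] assms(11) \<phi>\<^sub>s(2) by auto
    \<comment> \<open>The term with \<open>E\<close> restores what \<open>k\<close> subtracts, so
      \<open>?G\<close> is a primitive of the full integrand of \<open>S_ab\<close>.\<close>
    let ?G = "\<lambda>z. G1 t z + E z *\<^sub>C u\<^sub>0"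
    have "S_ab D A r \<theta> \<alpha> 1 t u\<^sub>0 = ?c *\<^sub>C ((P1 t + p *\<^sub>C u\<^sub>0) - (N1 t + n *\<^sub>C u\<^sub>0))"
      unfolding S_ab_def
    proof (subst ray_arc_integral_primitive[where G = ?G and P = "P1 t + p *\<^sub>C u\<^sub>0" and N = "N1 t + n *\<^sub>C u\<^sub>0"])
      fix z :: complex assume "\<bar>Im z\<bar> \<le> \<theta>"
      then have V: "\<bar>Im z\<bar> < \<phi>\<^sub>s" using assms(11) by simp
      have "exp z *\<^sub>C ((exp (exp z * of_real t) * exp z powr of_real (\<alpha> - 1)) *\<^sub>C ?S (exp z powr of_real \<alpha>) u\<^sub>0)
          = h1 t z + exp (of_real t * exp z) *\<^sub>C u\<^sub>0"
      proof -
        have "exp (of_real \<alpha> * z) = exp z * exp ((of_real \<alpha> - 1) * z)"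
          by (simp add: exp_add[symmetric] algebra_simps)
        then show ?thesis
          by (simp add: h1_def k_def powr_exp_strip[OF strip[OF V]] scaleC.diff_right scaleC_scaleC mult_ac)
      qed
      moreover have "has_cderiv (\<lambda>z. E z *\<^sub>C u\<^sub>0) (exp (of_real t * exp z) *\<^sub>C u\<^sub>0) z"
        using has_cderiv_scaleC[OF E has_cderiv_const] by simp
      ultimately show "has_cderiv ?G (exp z *\<^sub>C ((exp (exp z * of_real t) * exp z powr of_real (\<alpha> - 1)) *\<^sub>C
          ?S (exp z powr of_real \<alpha>) u\<^sub>0)) z"
        using has_cderiv_add[OF G1(1)[OF t V]] by simp
    next
      show "((\<lambda>x. ?G (Complex x \<theta>)) \<longlongrightarrow> P1 t + p *\<^sub>C u\<^sub>0) at_top"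
        by (intro tendsto_add scaleC.tendsto tendsto_const Ep G1(2)[OF t \<theta>s(5)])
      show "((\<lambda>x. ?G (Complex x (- \<theta>))) \<longlongrightarrow> N1 t + n *\<^sub>C u\<^sub>0) at_top"
        by (intro tendsto_add scaleC.tendsto tendsto_const En G1(3)[OF t \<theta>s(5)])
    qed (use assms(9) \<open>0 \<le> \<theta>\<close> in auto)
    also have "(P1 t + p *\<^sub>C u\<^sub>0) - (N1 t + n *\<^sub>C u\<^sub>0) = (P1 t - N1 t) + (p - n) *\<^sub>C u\<^sub>0"
      by (simp add: scaleC.diff_left)
    also have "?c *\<^sub>C \<dots> = ?c *\<^sub>C (P1 t - N1 t) + u\<^sub>0"
      by (simp add: pn scaleC_add_right scaleC_scaleC)
    finally show ?thesis using False by (simp add: S_a_def)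
  qed
  show ?thesis
    using S1 S2 G1(5) G2(5) uniformly_convergent_integral_subset[OF G1(4)]
      uniformly_convergent_integral_subset[OF G2(4)]
    unfolding h1_eq h2_eq by auto
qed

end
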